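(* Let $G_1,G_2$ be two groups (countable or not) with a common subgroup $G_0$. Suppose that $G_1$ acts on a metric space $X_1$ and $G_2$ acts on a metric space $X_2$, by isometries in both cases. Let $X_0$ be a common $G_0$-invariant subspace of $X_1$ and $X_2$, i.e. the restrictions of the two actions to $G_0$ and $X_0$ coincide. Then there is an amalgam of the two actions, which is an action of $G_1\ast_{G_0}G_2$ by isometries on a metric space of density character $\max\{|G_1\ast_{G_0} G_2|,\mathrm{dens}(X_1),\mathrm{dens}(X_2)\}$.
   Context: $G_1\ast_{G_0}G_2$ is the free product of $G_1$ and $G_2$ amalgamated over $G_0$; $G_1$ and $G_2$ are regarded as subgroups of it, and $|G_1\ast_{G_0}G_2|$ is its cardinality. An action of $G_1\ast_{G_0}G_2$ by isometries on a metric space $X_3$ is an amalgam of the actions of $G_1$ on $X_1$ and of $G_2$ on $X_2$ (over the common action of $G_0$ on $X_0$) if there are isometric embeddings $\rho_1:X_1\to X_3$ and $\rho_2:X_2\to X_3$ such that $\rho_i(g\cdot x)=g\cdot\rho_i(x)$ for all $g\in G_i$, $x\in X_i$, $i\in\{1,2\}$, and $\rho_1(x)=\rho_2(x)$ for all $x\in X_0$. The density character $\mathrm{dens}(X)$ of a metric space $X$ is the least cardinality of a dense subset of $X$.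
   Formalization: The common subspace X_0 is assumed nonempty, and the density character is shown to equal the maximum only when that maximum is infinite; when it is finite, only an amalgam of finite density character is claimed (the literal equality can fail there, as can the claim for empty X_0). *)

theory Defs
  imports "HOL-Algebra.Group_Action" "HOL-Analysis.Abstract_Metric_Spaces"
begin

unbundle cardinal_syntax
no_notation elt_set_eq (infix \<open>=o\<close> 50)

section \<open>Amalgamated free products\<close>

text \<open>
  The groups \<open>G1\<close> and \<open>G2\<close> live on the same type and share the subset \<open>G0\<close>; their carriers may
  overlap outside of \<open>G0\<close>, so letters are tagged by \<open>Inl\<close> and \<open>Inr\<close>.  The amalgamated free product
  is the monoid of words over the tagged letters modulo the congruence generated by the
  multiplication tables of both groups and by \<open>Inl h = Inr h\<close> for \<open>h \<in> G0\<close>.  The classes of letters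
  are invertible, so this monoid is a group.
\<close>

definition amalg_words :: "('g, 'm) monoid_scheme \<Rightarrow> ('g, 'n) monoid_scheme \<Rightarrow> ('g + 'g) list set"
  where "amalg_words G1 G2 = lists (carrier G1 <+> carrier G2)"

inductive_set amalg_rel ::
  "('g, 'm) monoid_scheme \<Rightarrow> 'g set \<Rightarrow> ('g, 'n) monoid_scheme \<Rightarrow> (('g + 'g) list \<times> ('g + 'g) list) set"
  for G1 G0 G2 where
  refl: "w \<in> amalg_words G1 G2 \<Longrightarrow> (w, w) \<in> amalg_rel G1 G0 G2"
| sym: "(u, v) \<in> amalg_rel G1 G0 G2 \<Longrightarrow> (v, u) \<in> amalg_rel G1 G0 G2"
| trans: "(u, v) \<in> amalg_rel G1 G0 G2 \<Longrightarrow> (v, w) \<in> amalg_rel G1 G0 G2 \<Longrightarrow> (u, w) \<in> amalg_rel G1 G0 G2"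
| append: "(u, u') \<in> amalg_rel G1 G0 G2 \<Longrightarrow> (v, v') \<in> amalg_rel G1 G0 G2
    \<Longrightarrow> (u @ v, u' @ v') \<in> amalg_rel G1 G0 G2"
| one1: "([Inl \<one>\<^bsub>G1\<^esub>], []) \<in> amalg_rel G1 G0 G2" if "\<one>\<^bsub>G1\<^esub> \<in> carrier G1"
| one2: "([Inr \<one>\<^bsub>G2\<^esub>], []) \<in> amalg_rel G1 G0 G2" if "\<one>\<^bsub>G2\<^esub> \<in> carrier G2"
| mult1: "([Inl a, Inl b], [Inl (a \<otimes>\<^bsub>G1\<^esub> b)]) \<in> amalg_rel G1 G0 G2"
    if "a \<in> carrier G1" "b \<in> carrier G1" "a \<otimes>\<^bsub>G1\<^esub> b \<in> carrier G1"
| mult2: "([Inr a, Inr b], [Inr (a \<otimes>\<^bsub>G2\<^esub> b)]) \<in> amalg_rel G1 G0 G2"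
    if "a \<in> carrier G2" "b \<in> carrier G2" "a \<otimes>\<^bsub>G2\<^esub> b \<in> carrier G2"
| amalg: "([Inl h], [Inr h]) \<in> amalg_rel G1 G0 G2"
    if "h \<in> G0" "h \<in> carrier G1" "h \<in> carrier G2"

definition amalg_prod ::
  "('g, 'm) monoid_scheme \<Rightarrow> 'g set \<Rightarrow> ('g, 'n) monoid_scheme \<Rightarrow> ('g + 'g) list set monoid"
  where "amalg_prod G1 G0 G2 =
    \<lparr>carrier = amalg_words G1 G2 // amalg_rel G1 G0 G2,
     mult = (\<lambda>A B. \<Union>u\<in>A. \<Union>v\<in>B. amalg_rel G1 G0 G2 `` {u @ v}),
     one = amalg_rel G1 G0 G2 `` {[]}\<rparr>"

definition amalg_incl1 ::
  "('g, 'm) monoid_scheme \<Rightarrow> 'g set \<Rightarrow> ('g, 'n) monoid_scheme \<Rightarrow> 'g \<Rightarrow> ('g + 'g) list set"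
  where "amalg_incl1 G1 G0 G2 g = amalg_rel G1 G0 G2 `` {[Inl g]}"

definition amalg_incl2 ::
  "('g, 'm) monoid_scheme \<Rightarrow> 'g set \<Rightarrow> ('g, 'n) monoid_scheme \<Rightarrow> 'g \<Rightarrow> ('g + 'g) list set"
  where "amalg_incl2 G1 G0 G2 g = amalg_rel G1 G0 G2 `` {[Inr g]}"

lemma amalg_rel_words:
  "(u, v) \<in> amalg_rel G1 G0 G2 \<Longrightarrow> u \<in> amalg_words G1 G2 \<and> v \<in> amalg_words G1 G2"
  by (induction rule: amalg_rel.induct) (auto simp: amalg_words_def)

lemma equiv_amalg_rel: "equiv (amalg_words G1 G2) (amalg_rel G1 G0 G2)"
proof (rule equivI)
  show "amalg_rel G1 G0 G2 \<subseteq> amalg_words G1 G2 \<times> amalg_words G1 G2"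
    using amalg_rel_words by fast
  show "refl_on (amalg_words G1 G2) (amalg_rel G1 G0 G2)"
    by (intro refl_onI amalg_rel.refl)
  show "sym_on UNIV (amalg_rel G1 G0 G2)"
    by (rule symI) (rule amalg_rel.sym)
  show "trans (amalg_rel G1 G0 G2)"
    by (rule transI) (rule amalg_rel.trans)
qed

lemma amalg_class_eq_iff:
  assumes "u \<in> amalg_words G1 G2" "v \<in> amalg_words G1 G2"
  shows "amalg_rel G1 G0 G2 `` {u} = amalg_rel G1 G0 G2 `` {v} \<longleftrightarrow> (u, v) \<in> amalg_rel G1 G0 G2"
  using eq_equiv_class_iff[OF equiv_amalg_rel assms] .

lemma amalg_mult_class:
  assumes "u \<in> amalg_words G1 G2" "v \<in> amalg_words G1 G2"
  shows "amalg_rel G1 G0 G2 `` {u} \<otimes>\<^bsub>amalg_prod G1 G0 G2\<^esub> amalg_rel G1 G0 G2 `` {v}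
    = amalg_rel G1 G0 G2 `` {u @ v}"
proof -
  have "amalg_rel G1 G0 G2 `` {u' @ v'} = amalg_rel G1 G0 G2 `` {u @ v}"
    if "(u, u') \<in> amalg_rel G1 G0 G2" "(v, v') \<in> amalg_rel G1 G0 G2" for u' v'
    using equiv_class_eq[OF equiv_amalg_rel amalg_rel.append[OF that]] by simp
  moreover have "(u, u) \<in> amalg_rel G1 G0 G2" "(v, v) \<in> amalg_rel G1 G0 G2"
    using assms by (auto intro: amalg_rel.refl)
  ultimately have "(\<Union>u'\<in>amalg_rel G1 G0 G2 `` {u}. \<Union>v'\<in>amalg_rel G1 G0 G2 `` {v}.
      amalg_rel G1 G0 G2 `` {u' @ v'}) = amalg_rel G1 G0 G2 `` {u @ v}"
    by blast
  then show ?thesis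
    by (simp add: amalg_prod_def)
qed

lemma group_amalg_prod:
  assumes "group G1" "group G2"
  shows "group (amalg_prod G1 G0 G2)"
proof -
  interpret G1: group G1 by fact
  interpret G2: group G2 by fact
  let ?R = "amalg_rel G1 G0 G2" and ?W = "amalg_words G1 G2" and ?P = "amalg_prod G1 G0 G2"
  have car: "A \<in> carrier ?P \<longleftrightarrow> (\<exists>w\<in>?W. A = ?R `` {w})" for A
    by (auto simp: amalg_prod_def quotient_def)
  have app: "u @ v \<in> ?W" if "u \<in> ?W" "v \<in> ?W" for u v
    using that by (simp add: amalg_words_def)
  have nil: "[] \<in> ?W"
    by (simp add: amalg_words_def)
  have one: "\<one>\<^bsub>?P\<^esub> = ?R `` {[]}"
    by (simp add: amalg_prod_def)
  have inv: "\<exists>v\<in>?W. (v @ w, []) \<in> ?R" if "w \<in> ?W" for w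
    using that unfolding amalg_words_def
  proof (induction w rule: lists.induct)
    case Nil
    show ?case by (auto intro!: bexI[of _ "[]"] amalg_rel.refl simp: amalg_words_def)
  next
    case (Cons x w)
    then obtain v where v: "v \<in> ?W" "(v @ w, []) \<in> ?R"
      by (auto simp: amalg_words_def)
    have "\<exists>y. [y] \<in> ?W \<and> ([y, x], []) \<in> ?R"
      using \<open>x \<in> carrier G1 <+> carrier G2\<close>
    proof (elim PlusE)
      fix a assume a: "a \<in> carrier G1" "x = Inl a"
      have "([Inl (inv\<^bsub>G1\<^esub> a), Inl a], [Inl \<one>\<^bsub>G1\<^esub>]) \<in> ?R"
        using amalg_rel.mult1[of "inv\<^bsub>G1\<^esub> a" G1 a G0 G2] a by simp
      from amalg_rel.trans[OF this amalg_rel.one1] show ?thesis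
        using a by (auto intro!: exI[of _ "Inl (inv\<^bsub>G1\<^esub> a)"] simp: amalg_words_def)
    next
      fix a assume a: "a \<in> carrier G2" "x = Inr a"
      have "([Inr (inv\<^bsub>G2\<^esub> a), Inr a], [Inr \<one>\<^bsub>G2\<^esub>]) \<in> ?R"
        using amalg_rel.mult2[of "inv\<^bsub>G2\<^esub> a" G2 a G1 G0] a by simp
      from amalg_rel.trans[OF this amalg_rel.one2] show ?thesis
        using a by (auto intro!: exI[of _ "Inr (inv\<^bsub>G2\<^esub> a)"] simp: amalg_words_def)
    qed
    then obtain y where y: "[y] \<in> ?W" "([y, x], []) \<in> ?R" by blast
    have w: "w \<in> ?W" using Cons by (simp add: amalg_words_def)
    have "((v @ [y, x]) @ w, (v @ []) @ w) \<in> ?R"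
      by (intro amalg_rel.append amalg_rel.refl v w y)
    then have "((v @ [y]) @ x # w, []) \<in> ?R"
      using amalg_rel.trans[OF _ v(2)] by simp
    moreover have "v @ [y] \<in> lists (carrier G1 <+> carrier G2)"
      using app[OF v(1) y(1)] by (simp add: amalg_words_def)
    ultimately show ?case by (rule rev_bexI[rotated])
  qed
  show ?thesis
  proof (rule groupI)
    fix A B C assume "A \<in> carrier ?P" "B \<in> carrier ?P" "C \<in> carrier ?P"
    then obtain u v w where w: "u \<in> ?W" "v \<in> ?W" "w \<in> ?W"
      and A: "A = ?R `` {u}" "B = ?R `` {v}" "C = ?R `` {w}"
      unfolding car by blast
    show "A \<otimes>\<^bsub>?P\<^esub> B \<otimes>\<^bsub>?P\<^esub> C = A \<otimes>\<^bsub>?P\<^esub> (B \<otimes>\<^bsub>?P\<^esub> C)"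
      unfolding A amalg_mult_class[OF w(1,2)] amalg_mult_class[OF w(2,3)]
        amalg_mult_class[OF app[OF w(1,2)] w(3)] amalg_mult_class[OF w(1) app[OF w(2,3)]]
      by simp
  next
    fix A assume "A \<in> carrier ?P"
    then obtain w where w: "w \<in> ?W" "A = ?R `` {w}" unfolding car by blast
    with inv obtain v where v: "v \<in> ?W" "(v @ w, []) \<in> ?R" by blast
    have "?R `` {v} \<otimes>\<^bsub>?P\<^esub> A = \<one>\<^bsub>?P\<^esub>"
      unfolding w(2) amalg_mult_class[OF v(1) w(1)] one
      by (rule equiv_class_eq[OF equiv_amalg_rel v(2)])
    moreover have "?R `` {v} \<in> carrier ?P"
      unfolding car using v(1) by blast
    ultimately show "\<exists>B\<in>carrier ?P. B \<otimes>\<^bsub>?P\<^esub> A = \<one>\<^bsub>?P\<^esub>"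
      by blast
  next
    fix A B assume "A \<in> carrier ?P" "B \<in> carrier ?P"
    then obtain u v where w: "u \<in> ?W" "v \<in> ?W" and A: "A = ?R `` {u}" "B = ?R `` {v}"
      unfolding car by blast
    show "A \<otimes>\<^bsub>?P\<^esub> B \<in> carrier ?P"
      unfolding car A amalg_mult_class[OF w] using app[OF w] by blast
  next
    show "\<one>\<^bsub>?P\<^esub> \<in> carrier ?P"
      unfolding car one using nil by blast
  next
    fix A assume "A \<in> carrier ?P"
    then obtain w where w: "w \<in> ?W" "A = ?R `` {w}"
      unfolding car by blast
    show "\<one>\<^bsub>?P\<^esub> \<otimes>\<^bsub>?P\<^esub> A = A"
      unfolding one w(2) amalg_mult_class[OF nil w(1)] by simp
  qed
qed

lemma amalg_incl1_hom:
  assumes "group G1" "group G2"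
  shows "amalg_incl1 G1 G0 G2 \<in> hom G1 (amalg_prod G1 G0 G2)"
proof (rule homI)
  interpret G1: group G1 by fact
  fix a b assume ab: "a \<in> carrier G1" "b \<in> carrier G1"
  then have W: "[Inl a] \<in> amalg_words G1 G2" "[Inl b] \<in> amalg_words G1 G2"
    by (auto simp: amalg_words_def)
  show "amalg_incl1 G1 G0 G2 a \<in> carrier (amalg_prod G1 G0 G2)"
    using W by (auto simp: amalg_prod_def amalg_incl1_def intro: quotientI)
  show "amalg_incl1 G1 G0 G2 (a \<otimes>\<^bsub>G1\<^esub> b) =
    amalg_incl1 G1 G0 G2 a \<otimes>\<^bsub>amalg_prod G1 G0 G2\<^esub> amalg_incl1 G1 G0 G2 b"
    unfolding amalg_incl1_def amalg_mult_class[OF W] append.simps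
    by (rule equiv_class_eq[OF equiv_amalg_rel, symmetric])
      (rule amalg_rel.mult1[OF ab G1.m_closed[OF ab]])
qed

lemma amalg_incl2_hom:
  assumes "group G1" "group G2"
  shows "amalg_incl2 G1 G0 G2 \<in> hom G2 (amalg_prod G1 G0 G2)"
proof (rule homI)
  interpret G2: group G2 by fact
  fix a b assume ab: "a \<in> carrier G2" "b \<in> carrier G2"
  then have W: "[Inr a] \<in> amalg_words G1 G2" "[Inr b] \<in> amalg_words G1 G2"
    by (auto simp: amalg_words_def)
  show "amalg_incl2 G1 G0 G2 a \<in> carrier (amalg_prod G1 G0 G2)"
    using W by (auto simp: amalg_prod_def amalg_incl2_def intro: quotientI)
  show "amalg_incl2 G1 G0 G2 (a \<otimes>\<^bsub>G2\<^esub> b) =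
    amalg_incl2 G1 G0 G2 a \<otimes>\<^bsub>amalg_prod G1 G0 G2\<^esub> amalg_incl2 G1 G0 G2 b"
    unfolding amalg_incl2_def amalg_mult_class[OF W] append.simps
    by (rule equiv_class_eq[OF equiv_amalg_rel, symmetric])
      (rule amalg_rel.mult2[OF ab G2.m_closed[OF ab]])
qed

lemma amalg_incl_agree:
  assumes "subgroup G0 G1" "subgroup G0 G2" "h \<in> G0"
  shows "amalg_incl1 G1 G0 G2 h = amalg_incl2 G1 G0 G2 h"
  unfolding amalg_incl1_def amalg_incl2_def
  by (intro equiv_class_eq[OF equiv_amalg_rel] amalg_rel.amalg)
    (use assms in \<open>auto dest: subgroup.mem_carrier\<close>)


section \<open>Isometric actions and their amalgams\<close>

definition isometric_action ::
  "('g, 'm) monoid_scheme \<Rightarrow> 'x set \<Rightarrow> ('x \<Rightarrow> 'x \<Rightarrow> real) \<Rightarrow> ('g \<Rightarrow> 'x \<Rightarrow> 'x) \<Rightarrow> bool"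
  where "isometric_action G X d \<phi> \<longleftrightarrow>
    Metric_space X d \<and> group_action G X \<phi> \<and>
    (\<forall>g\<in>carrier G. \<forall>x\<in>X. \<forall>y\<in>X. d (\<phi> g x) (\<phi> g y) = d x y)"

definition isometric_embedding ::
  "'x set \<Rightarrow> ('x \<Rightarrow> 'x \<Rightarrow> real) \<Rightarrow> 'y set \<Rightarrow> ('y \<Rightarrow> 'y \<Rightarrow> real) \<Rightarrow> ('x \<Rightarrow> 'y) \<Rightarrow> bool"
  where "isometric_embedding X d Y e \<rho> \<longleftrightarrow>
    \<rho> \<in> X \<rightarrow> Y \<and> (\<forall>x\<in>X. \<forall>y\<in>X. e (\<rho> x) (\<rho> y) = d x y)"

definition amalgam_of_actions ::
  "('g, 'm) monoid_scheme \<Rightarrow> 'g set \<Rightarrow> ('g, 'n) monoid_scheme \<Rightarrow>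
   'x set \<Rightarrow>
   'x set \<Rightarrow> ('x \<Rightarrow> 'x \<Rightarrow> real) \<Rightarrow> ('g \<Rightarrow> 'x \<Rightarrow> 'x) \<Rightarrow>
   'x set \<Rightarrow> ('x \<Rightarrow> 'x \<Rightarrow> real) \<Rightarrow> ('g \<Rightarrow> 'x \<Rightarrow> 'x) \<Rightarrow>
   'y set \<Rightarrow> ('y \<Rightarrow> 'y \<Rightarrow> real) \<Rightarrow> (('g + 'g) list set \<Rightarrow> 'y \<Rightarrow> 'y) \<Rightarrow> bool"
  where "amalgam_of_actions G1 G0 G2 X0 X1 d1 \<phi>1 X2 d2 \<phi>2 X3 d3 \<phi>3 \<longleftrightarrow>
    isometric_action (amalg_prod G1 G0 G2) X3 d3 \<phi>3 \<and>
    (\<exists>\<rho>1 \<rho>2.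
      isometric_embedding X1 d1 X3 d3 \<rho>1 \<and>
      isometric_embedding X2 d2 X3 d3 \<rho>2 \<and>
      (\<forall>g\<in>carrier G1. \<forall>x\<in>X1. \<rho>1 (\<phi>1 g x) = \<phi>3 (amalg_incl1 G1 G0 G2 g) (\<rho>1 x)) \<and>
      (\<forall>g\<in>carrier G2. \<forall>x\<in>X2. \<rho>2 (\<phi>2 g x) = \<phi>3 (amalg_incl2 G1 G0 G2 g) (\<rho>2 x)) \<and>
      (\<forall>x\<in>X0. \<rho>1 x = \<rho>2 x))"


section \<open>Density character\<close>

definition metric_dense :: "'x set \<Rightarrow> ('x \<Rightarrow> 'x \<Rightarrow> real) \<Rightarrow> 'x set \<Rightarrow> bool"
  where "metric_dense X d D \<longleftrightarrow> D \<subseteq> X \<and> Metric_space.mtopology X d closure_of D = X"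

text \<open>
  Cardinals are cardinal well-orders, to be compared by \<open>=o\<close> and \<open>\<le>o\<close> only; the choice of the dense
  set of least cardinality is therefore immaterial.
\<close>

definition dens :: "'x set \<Rightarrow> ('x \<Rightarrow> 'x \<Rightarrow> real) \<Rightarrow> 'x rel"
  where "dens X d =
    |SOME D. metric_dense X d D \<and> (\<forall>E. metric_dense X d E \<longrightarrow> |D| \<le>o |E| )|"

lemma dens_least:
  assumes "Metric_space X d"
  shows "\<exists>D. metric_dense X d D \<and> dens X d = |D|"
    and "metric_dense X d E \<Longrightarrow> dens X d \<le>o |E|"
proof -
  interpret Metric_space X d by fact
  have X: "metric_dense X d X"
    unfolding metric_dense_def using closure_of_topspace[of mtopology] by simp
  obtain r where r: "r \<in> card_of ` Collect (metric_dense X d)"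
    "\<forall>r' \<in> card_of ` Collect (metric_dense X d). r \<le>o r'"
    using exists_minim_Well_order[of "card_of ` Collect (metric_dense X d)"] X card_of_Well_order
    by blast
  then have "\<exists>D. metric_dense X d D \<and> (\<forall>E. metric_dense X d E \<longrightarrow> |D| \<le>o |E| )"
    by blast
  from someI_ex[OF this]
  show "\<exists>D. metric_dense X d D \<and> dens X d = |D|"
    and "metric_dense X d E \<Longrightarrow> dens X d \<le>o |E|"
    unfolding dens_def by blast+
qed

text \<open>
  The maximum of two cardinals.  They may live on different types, hence the larger one is
  transported to the sum type.
\<close>

definition card_max :: "'a rel \<Rightarrow> 'b rel \<Rightarrow> ('a + 'b) rel"
  where "card_max r s = (if s \<le>o r then dir_image r Inl else dir_image s Inr)"

lemma card_max_ordIso: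
  assumes "Card_order r" "Card_order s"
  shows "s \<le>o r \<Longrightarrow> card_max r s =o r" and "r \<le>o s \<Longrightarrow> card_max r s =o s"
proof -
  have r: "dir_image r Inl =o r" and s: "dir_image s Inr =o s"
    using dir_image[of Inl r] dir_image[of Inr s] assms by (auto intro: ordIso_symmetric)
  show "s \<le>o r \<Longrightarrow> card_max r s =o r"
    using r by (simp add: card_max_def)
  assume "r \<le>o s"
  show "card_max r s =o s"
  proof (cases "s \<le>o r")
    case True
    with \<open>r \<le>o s\<close> have "r =o s" by (simp add: ordIso_iff_ordLeq)
    with True r show ?thesis by (simp add: card_max_def ordIso_transitive[OF r])
  qed (use s in \<open>simp add: card_max_def\<close>)
qed

end

theory Submission
  imports Defs
begin

text \<open>
  The amalgam is a quotient of \<open>P \<times> (X1 + X2)\<close>, where \<open>P\<close> is the amalgamated product and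
  \<open>(A, x)\<close> stands for the translate \<open>A \<cdot> x\<close>.  The distance is defined from the dual side: a family \<open>\<Omega>\<close> of
  "states" is constructed, each of which assigns a real value to every point \<open>(A, x)\<close>, and the
  distance of two points is the supremum over all states of the difference of their values.
  Such a supremum is a pseudometric for free.  It is invariant under \<open>P\<close> if \<open>P\<close> permutes the
  states, it identifies what has to be identified if the values respect the identifications, and
  it restricts to the given metrics if the values are 1-Lipschitz on \<open>X1\<close> and on \<open>X2\<close> and if every
  distance function \<open>d1 x\<close> on \<open>X1\<close> and \<open>d2 x\<close> on \<open>X2\<close> comes from a state.

  A state thus determines a pair of 1-Lipschitz functions on \<open>X1\<close> and \<open>X2\<close> that agree on \<open>X0\<close>, and
  \<open>P\<close> must act on the states in such a way that \<open>g \<in> G1\<close> translates the first component of the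
  pair and \<open>g \<in> G2\<close> the second one.  To let \<open>P\<close> act is to let \<open>G1\<close> and \<open>G2\<close> act in a way that
  coincides on \<open>G0\<close>.
  On the pairs themselves only \<open>G0\<close> acts, because a translate of the first
  component by \<open>g \<in> G1\<close> carries no instruction for the second one.  The remedy is to inflate:
  let \<open>B\<close> be the set of pairs and let \<open>\<Omega> = B \<times> N \<times> G0\<close> with a huge set \<open>N\<close> and \<open>G0\<close> acting freely
  by right multiplication on the last factor.  The \<open>G1\<close>-set \<open>B \<times> N \<times> G1\<close> also maps to
  pairs: off \<open>G0\<close> the second component is discarded and the translated first
  component is extended canonically, by McShane's formula, which is \<open>G0\<close>-equivariant.  If one
  chooses representatives of its \<open>G0\<close>-orbits, exactly \<open>|N|\<close> of them lie over every pair, just like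
  in \<open>\<Omega>\<close>; as \<open>G0\<close> acts freely, the two sets are isomorphic over \<open>B\<close>, and the \<open>G1\<close>-action can be
  transported to \<open>\<Omega>\<close>.  This is \<open>free_extension\<close>.
  The same works for \<open>G2\<close>, and since both transported actions extend the same \<open>G0\<close>-action on \<open>\<Omega>\<close>,
  they combine to an action of \<open>P\<close>.

  For the density character, a copy of \<open>P\<close> consisting of points at distance at least 1 from
  everything else is attached, one hair at each translate of a base point.  A dense subset must
  contain all these points, so its cardinality is at least \<open>|P|\<close>; if it is infinite, it is also
  at least \<open>dens X1\<close> and \<open>dens X2\<close>, because these spaces embed; and conversely the translates
  of dense subsets of \<open>X1\<close> and \<open>X2\<close> together with the hairs are dense.
\<close>

section \<open>Extending free actions\<close>

lemma (in group) mult_subgroup_mem_iff: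
  assumes "subgroup H G" "x \<in> carrier G" "h \<in> H"
  shows "x \<otimes> h \<in> H \<longleftrightarrow> x \<in> H"
proof -
  interpret H: subgroup H G by fact
  show ?thesis
    proof
      assume "x \<otimes> h \<in> H"
      then have "(x \<otimes> h) \<otimes> inv h \<in> H" using assms by simp
      then show "x \<in> H" using assms by (simp add: m_assoc)
    qed (use assms in simp)
qed

text \<open>
  Taking \<open>\<one>\<close> as the representative of the coset \<open>H\<close> itself puts a representative over every
  point of \<open>B\<close> in \<open>free_extension\<close>.
\<close>

lemma (in group) left_transversal:
  assumes "subgroup H G"
  obtains t where
    "\<And>g. g \<in> carrier G \<Longrightarrow> t g \<in> carrier G"
    "\<And>g. g \<in> carrier G \<Longrightarrow> inv (t g) \<otimes> g \<in> H"
    "\<And>g h. g \<in> carrier G \<Longrightarrow> h \<in> H \<Longrightarrow> t (g \<otimes> h) = t g"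
    "\<And>h. h \<in> H \<Longrightarrow> t h = \<one>"
proof -
  interpret H: subgroup H G by fact
  define t where "t g = (if g \<in> H then \<one> else (SOME x. x \<in> carrier G \<and> inv x \<otimes> g \<in> H))" for g
  have ex: "t g \<in> carrier G \<and> inv (t g) \<otimes> g \<in> H" if g: "g \<in> carrier G" for g
  proof (cases "g \<in> H")
    case False
    have "\<exists>x. x \<in> carrier G \<and> inv x \<otimes> g \<in> H"
      using g by (intro exI[of _ g]) simp
    from someI_ex[OF this] show ?thesis
      using False by (simp add: t_def)
  qed (use g in \<open>simp add: t_def\<close>)
  have "t (g \<otimes> h) = t g" if g: "g \<in> carrier G" and h: "h \<in> H" for g h
  proof -
    have "inv x \<otimes> (g \<otimes> h) \<in> H \<longleftrightarrow> inv x \<otimes> g \<in> H" if "x \<in> carrier G" for x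
      using mult_subgroup_mem_iff[OF assms, of "inv x \<otimes> g" h] that g h by (simp add: m_assoc)
    then have "(SOME x. x \<in> carrier G \<and> inv x \<otimes> (g \<otimes> h) \<in> H) =
        (SOME x. x \<in> carrier G \<and> inv x \<otimes> g \<in> H)"
      by (metis (no_types, lifting))
    then show ?thesis
      by (simp add: t_def mult_subgroup_mem_iff[OF assms] g h)
  qed
  with ex show ?thesis
    by (intro that[of t]) (auto simp: t_def)
qed

text \<open>
  The free \<open>H\<close>-set \<open>B \<times> N \<times> H\<close> over \<open>B\<close> has so many orbits over each point that it is
  isomorphic to the restriction of a \<open>G\<close>-set, so its \<open>H\<close>-action extends to \<open>G\<close> as soon as a coarser shadow \<open>r : B \<rightarrow> C\<close> of the action on
  \<open>B\<close> does so and \<open>r\<close> has an \<open>H\<close>-equivariant section \<open>s\<close>.  The map to \<open>B\<close> sends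
  \<open>(b, n, k)\<close> to \<open>a k b\<close>.  All actions are right actions.
\<close>

lemma free_extension:
  fixes G (structure) and H :: "'g set"
    and B :: "'b set" and a :: "'g \<Rightarrow> 'b \<Rightarrow> 'b"
    and C :: "'c set" and c :: "'g \<Rightarrow> 'c \<Rightarrow> 'c"
    and r :: "'b \<Rightarrow> 'c" and s :: "'c \<Rightarrow> 'b"
  assumes G: "group G" and H: "subgroup H G"
    and a: "\<And>h b. h \<in> H \<Longrightarrow> b \<in> B \<Longrightarrow> a h b \<in> B" "\<And>b. b \<in> B \<Longrightarrow> a \<one> b = b"
      "\<And>h k b. h \<in> H \<Longrightarrow> k \<in> H \<Longrightarrow> b \<in> B \<Longrightarrow> a (h \<otimes> k) b = a k (a h b)"
    and c: "\<And>g y. g \<in> carrier G \<Longrightarrow> y \<in> C \<Longrightarrow> c g y \<in> C"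
      "\<And>g h y. g \<in> carrier G \<Longrightarrow> h \<in> carrier G \<Longrightarrow> y \<in> C \<Longrightarrow> c (g \<otimes> h) y = c h (c g y)"
    and r: "\<And>b. b \<in> B \<Longrightarrow> r b \<in> C" "\<And>h b. h \<in> H \<Longrightarrow> b \<in> B \<Longrightarrow> r (a h b) = c h (r b)"
    and s: "\<And>y. y \<in> C \<Longrightarrow> s y \<in> B" "\<And>y. y \<in> C \<Longrightarrow> r (s y) = y"
      "\<And>h y. h \<in> H \<Longrightarrow> y \<in> C \<Longrightarrow> s (c h y) = a h (s y)"
    and N: "infinite (UNIV :: 'n set)" "|B \<times> carrier G| \<le>o |UNIV :: 'n set|"
  obtains \<alpha> :: "'g \<Rightarrow> 'b \<times> 'n \<times> 'g \<Rightarrow> 'b \<times> 'n \<times> 'g" where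
    "\<And>g \<omega>. g \<in> carrier G \<Longrightarrow> \<omega> \<in> B \<times> UNIV \<times> H \<Longrightarrow> \<alpha> g \<omega> \<in> B \<times> UNIV \<times> H"
    "\<And>g h \<omega>. g \<in> carrier G \<Longrightarrow> h \<in> carrier G \<Longrightarrow> \<omega> \<in> B \<times> UNIV \<times> H
      \<Longrightarrow> \<alpha> (g \<otimes> h) \<omega> = \<alpha> h (\<alpha> g \<omega>)"
    "\<And>h b n k. h \<in> H \<Longrightarrow> b \<in> B \<Longrightarrow> k \<in> H \<Longrightarrow> \<alpha> h (b, n, k) = (b, n, k \<otimes> h)"
    "\<And>g \<omega>. g \<in> carrier G \<Longrightarrow> \<omega> \<in> B \<times> UNIV \<times> H
      \<Longrightarrow> r (case \<alpha> g \<omega> of (b, n, k) \<Rightarrow> a k b) = c g (r (case \<omega> of (b, n, k) \<Rightarrow> a k b))"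
proof -
  interpret group G by fact
  interpret H: subgroup H G by fact
  let ?\<Omega> = "B \<times> (UNIV :: 'n set) \<times> H"
  let ?Q = "B \<times> (UNIV :: 'n set) \<times> carrier G"
  obtain t where t: "\<And>g. g \<in> carrier G \<Longrightarrow> t g \<in> carrier G"
      "\<And>g. g \<in> carrier G \<Longrightarrow> inv (t g) \<otimes> g \<in> H"
      "\<And>g h. g \<in> carrier G \<Longrightarrow> h \<in> H \<Longrightarrow> t (g \<otimes> h) = t g"
      "\<And>h. h \<in> H \<Longrightarrow> t h = \<one>"
    by (rule left_transversal[OF H]) (rule that)
  have split: "t g \<otimes> (inv (t g) \<otimes> g) = g" if "g \<in> carrier G" for g
    using that t(1) by (simp add: m_assoc[symmetric])
  have tt: "t (t g) = t g" if "g \<in> carrier G" for g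
    using t(3)[OF t(1)[OF that] t(2)[OF that]] split[OF that] by simp

  \<comment> \<open>The map to \<open>B\<close> of the competing \<open>G\<close>-set \<open>?Q\<close>, on which \<open>G\<close> acts by right multiplication.
    Off \<open>H\<close>, where only \<open>c g (r b)\<close> is known, the section supplies the rest.\<close>
  define val where "val b g = (if g \<in> H then a g b else s (c g (r b)))" for b g
  have val_B: "val b g \<in> B" if "b \<in> B" "g \<in> carrier G" for b g
    using that by (simp add: val_def a c r s)
  have val_mult: "val b (g \<otimes> h) = a h (val b g)" if "b \<in> B" "g \<in> carrier G" "h \<in> H" for b g h
    using that by (simp add: val_def mult_subgroup_mem_iff[OF H] a c r s)
  have r_val: "r (val b g) = c g (r b)" if "b \<in> B" "g \<in> carrier G" for b g
    using that by (simp add: val_def c r s)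

  \<comment> \<open>\<open>F y \<times> UNIV\<close> indexes the \<open>H\<close>-orbits of \<open>?Q\<close> whose distinguished representative lies over \<open>y\<close>.\<close>
  define F where "F y = {(b, g). b \<in> B \<and> g \<in> carrier G \<and> t g = g \<and> val b g = y}" for y
  have "\<exists>\<tau>. bij_betw \<tau> (F y \<times> (UNIV :: 'n set)) (UNIV :: 'n set)" if y: "y \<in> B" for y
  proof -
    have "(y, \<one>) \<in> F y"
      using y by (simp add: F_def t(4) val_def a)
    moreover have "|F y| \<le>o |UNIV :: 'n set|"
      by (rule ordLeq_transitive[OF card_of_mono1 N(2)]) (auto simp: F_def)
    ultimately have "|F y \<times> (UNIV :: 'n set)| =o |UNIV :: 'n set|"
      using card_of_Times_infinite[OF N(1), of "F y"] by blast
    then show ?thesis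
      by (simp add: card_of_ordIso)
  qed
  then obtain \<tau> where \<tau>: "\<And>y. y \<in> B \<Longrightarrow> bij_betw (\<tau> y) (F y \<times> (UNIV :: 'n set)) (UNIV :: 'n set)"
    by metis

  define \<theta> where "\<theta> = (\<lambda>(b, n, g).
    (val b (t g), \<tau> (val b (t g)) ((b, t g), n), inv (t g) \<otimes> g))"
  have \<theta>_mult: "\<theta> (b, n, g \<otimes> h) = (case \<theta> (b, n, g) of (y, m, k) \<Rightarrow> (y, m, k \<otimes> h))"
    if "g \<in> carrier G" "h \<in> H" for b n g h
    using that t by (simp add: \<theta>_def m_assoc)
  have \<theta>_val: "(case \<theta> (b, n, g) of (y, m, k) \<Rightarrow> a k y) = val b g"
    if "b \<in> B" "g \<in> carrier G" for b n g
    using val_mult[OF that(1) t(1) t(2), OF that(2) that(2)] split[OF that(2)] by (simp add: \<theta>_def)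
  have F_t: "(b, t g) \<in> F (val b (t g))" if "b \<in> B" "g \<in> carrier G" for b g
    using that by (simp add: F_def t tt)
  have bij: "bij_betw \<theta> ?Q ?\<Omega>"
    unfolding bij_betw_def
  proof
    show "inj_on \<theta> ?Q"
    proof (rule inj_onI, clarsimp simp: \<theta>_def)
      fix b n g b' n' g'
      assume *: "b \<in> B" "g \<in> carrier G" "b' \<in> B" "g' \<in> carrier G"
        and v: "val b (t g) = val b' (t g')"
        and eq: "\<tau> (val b' (t g')) ((b, t g), n) = \<tau> (val b' (t g')) ((b', t g'), n')"
        and k: "inv (t g) \<otimes> g = inv (t g') \<otimes> g'"
      have "inj_on (\<tau> (val b' (t g'))) (F (val b' (t g')) \<times> UNIV)"
        using \<tau>[OF val_B] * t(1) by (auto simp: bij_betw_def)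
      from inj_onD[OF this eq] have "b = b'" "t g = t g'" "n = n'"
        using F_t[of b g] F_t[of b' g'] * v by auto
      with k split[of g] split[of g'] * show "b = b' \<and> n = n' \<and> g = g'"
        by metis
    qed
    show "\<theta> ` ?Q = ?\<Omega>"
    proof
      show "\<theta> ` ?Q \<subseteq> ?\<Omega>"
        by (auto simp: \<theta>_def val_B t)
      show "?\<Omega> \<subseteq> \<theta> ` ?Q"
      proof clarify
        fix y and m :: 'n and k assume y: "y \<in> B" and k: "k \<in> H"
        have "m \<in> \<tau> y ` (F y \<times> UNIV)"
          using \<tau>[OF y] by (simp add: bij_betw_def)
        then obtain b g n where bg: "(b, g) \<in> F y" and m: "m = \<tau> y ((b, g), n)"
          by auto
        then have "\<theta> (b, n, g \<otimes> k) = (y, m, k)" "(b, n, g \<otimes> k) \<in> ?Q"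
          using k by (auto simp: F_def \<theta>_def t(3) m_assoc[symmetric])
        then show "(y, m, k) \<in> \<theta> ` ?Q"
          by (metis imageI)
      qed
    qed
  qed

  \<comment> \<open>Transport of right multiplication from \<open>?Q\<close> along the isomorphism \<open>\<theta>\<close> of \<open>H\<close>-sets over \<open>B\<close>.\<close>
  define \<alpha> where "\<alpha> g \<omega> = (case inv_into ?Q \<theta> \<omega> of (b, n, k) \<Rightarrow> \<theta> (b, n, k \<otimes> g))" for g \<omega>
  have \<alpha>: "\<alpha> g (\<theta> (b, n, k)) = \<theta> (b, n, k \<otimes> g)" if "b \<in> B" "k \<in> carrier G" for g b n k
    using that bij by (simp add: \<alpha>_def bij_betw_inv_into_left)
  have ex: "\<exists>b n k. \<omega> = \<theta> (b, n, k) \<and> b \<in> B \<and> k \<in> carrier G" if "\<omega> \<in> ?\<Omega>" for \<omega>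
    using that bij by (fastforce simp: bij_betw_def)
  have in\<Omega>: "\<theta> (b, n, k) \<in> ?\<Omega>" if "b \<in> B" "k \<in> carrier G" for b n k
    using that bij by (auto simp: bij_betw_def)
  show ?thesis
  proof (rule that[of \<alpha>])
    fix g \<omega> assume g: "g \<in> carrier G" and \<omega>: "\<omega> \<in> ?\<Omega>"
    from ex[OF \<omega>] obtain b n k where *: "\<omega> = \<theta> (b, n, k)" "b \<in> B" "k \<in> carrier G"
      by blast
    show "\<alpha> g \<omega> \<in> ?\<Omega>"
      using in\<Omega>[of b "k \<otimes> g" n] * g by (simp add: \<alpha>)
    show "r (case \<alpha> g \<omega> of (b, n, k) \<Rightarrow> a k b) = c g (r (case \<omega> of (b, n, k) \<Rightarrow> a k b))"
      using * g by (simp add: \<alpha> \<theta>_val r_val c r)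
    fix h assume h: "h \<in> carrier G"
    show "\<alpha> (g \<otimes> h) \<omega> = \<alpha> h (\<alpha> g \<omega>)"
      using * g h by (simp add: \<alpha> m_assoc)
  next
    fix h b k and n :: 'n assume *: "h \<in> H" "b \<in> B" "k \<in> H"
    then have "(b, n, k) \<in> ?\<Omega>" by simp
    from ex[OF this] obtain b' n' k' where "(b, n, k) = \<theta> (b', n', k')" "b' \<in> B" "k' \<in> carrier G"
      by blast
    then show "\<alpha> h (b, n, k) = (b, n, k \<otimes> h)"
      using * \<theta>_mult[of k' h b' n'] \<alpha>[of b' k' h n'] by (metis (no_types, lifting) case_prod_conv)
  qed
qed

section \<open>Equivariant extension of Lipschitz functions\<close>

lemma isometric_actionD:
  assumes "isometric_action G X d \<phi>"
  shows "Metric_space X d"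
    and "g \<in> carrier G \<Longrightarrow> x \<in> X \<Longrightarrow> \<phi> g x \<in> X"
    and "x \<in> X \<Longrightarrow> \<phi> \<one>\<^bsub>G\<^esub> x = x"
    and "g \<in> carrier G \<Longrightarrow> h \<in> carrier G \<Longrightarrow> x \<in> X \<Longrightarrow> \<phi> (g \<otimes>\<^bsub>G\<^esub> h) x = \<phi> g (\<phi> h x)"
    and "g \<in> carrier G \<Longrightarrow> x \<in> X \<Longrightarrow> y \<in> X \<Longrightarrow> d (\<phi> g x) (\<phi> g y) = d x y"
proof -
  show "Metric_space X d"
    using assms by (simp add: isometric_action_def)
  interpret group_action G X \<phi>
    using assms by (simp add: isometric_action_def)
  show "g \<in> carrier G \<Longrightarrow> x \<in> X \<Longrightarrow> \<phi> g x \<in> X"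
    using element_image by blast
  show "x \<in> X \<Longrightarrow> \<phi> \<one>\<^bsub>G\<^esub> x = x"
    using id_eq_one by (metis restrict_apply')
  show "g \<in> carrier G \<Longrightarrow> h \<in> carrier G \<Longrightarrow> x \<in> X \<Longrightarrow> \<phi> (g \<otimes>\<^bsub>G\<^esub> h) x = \<phi> g (\<phi> h x)"
    by (rule composition_rule)
  show "g \<in> carrier G \<Longrightarrow> x \<in> X \<Longrightarrow> y \<in> X \<Longrightarrow> d (\<phi> g x) (\<phi> g y) = d x y"
    using assms by (simp add: isometric_action_def)
qed

text \<open>
  Restricting to extensional functions makes the laws of a right action hold as equations
  between functions.
\<close>

definition lipschitz1 :: "'x set \<Rightarrow> ('x \<Rightarrow> 'x \<Rightarrow> real) \<Rightarrow> ('x \<Rightarrow> real) set"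
  where "lipschitz1 X d = {f \<in> extensional X. \<forall>x\<in>X. \<forall>y\<in>X. f x \<le> f y + d x y}"

definition mcshane :: "'x set \<Rightarrow> 'x set \<Rightarrow> ('x \<Rightarrow> 'x \<Rightarrow> real) \<Rightarrow> ('x \<Rightarrow> real) \<Rightarrow> 'x \<Rightarrow> real"
  where "mcshane Z X d f = (\<lambda>x\<in>X. INF z\<in>Z. f z + d z x)"

context
  fixes Z X :: "'x set" and d :: "'x \<Rightarrow> 'x \<Rightarrow> real" and f :: "'x \<Rightarrow> real"
  assumes metric: "Metric_space X d" and Z: "Z \<subseteq> X" "Z \<noteq> {}"
    and f: "\<And>z w. z \<in> Z \<Longrightarrow> w \<in> Z \<Longrightarrow> f z \<le> f w + d z w"
begin

interpretation Metric_space X d by (rule metric)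

lemma bdd_below_mcshane:
  assumes "x \<in> X"
  shows "bdd_below ((\<lambda>z. f z + d z x) ` Z)"
proof -
  obtain w where w: "w \<in> Z" using Z by blast
  have "f w - d w x \<le> f z + d z x" if "z \<in> Z" for z
    using f[OF w that] triangle[of w x z] that w assms Z commute[of x z] by (simp add: subset_iff)
  then show ?thesis
    by (intro bdd_belowI2)
qed

lemma mcshane_le: "x \<in> X \<Longrightarrow> z \<in> Z \<Longrightarrow> mcshane Z X d f x \<le> f z + d z x"
  using cINF_lower[OF bdd_below_mcshane] by (simp add: mcshane_def)

lemma le_mcshane: "x \<in> X \<Longrightarrow> (\<And>z. z \<in> Z \<Longrightarrow> c \<le> f z + d z x) \<Longrightarrow> c \<le> mcshane Z X d f x"
  by (simp add: mcshane_def cINF_greatest[OF Z(2)])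

lemma mcshane_extends:
  assumes z: "z \<in> Z"
  shows "mcshane Z X d f z = f z"
proof (rule antisym)
  show "mcshane Z X d f z \<le> f z"
    using mcshane_le[of z z] z Z by (simp add: subset_iff)
  show "f z \<le> mcshane Z X d f z"
    using z Z f[OF z] by (intro le_mcshane) (auto simp: commute)
qed

lemma mcshane_lipschitz1: "mcshane Z X d f \<in> lipschitz1 X d"
proof -
  have "mcshane Z X d f x \<le> mcshane Z X d f y + d x y" if xy: "x \<in> X" "y \<in> X" for x y
  proof -
    have "mcshane Z X d f x - d x y \<le> mcshane Z X d f y"
    proof (rule le_mcshane)
      fix z assume "z \<in> Z"
      then show "mcshane Z X d f x - d x y \<le> f z + d z y"
        using mcshane_le[of x z] triangle[of z y x] xy Z commute[of x y] by (simp add: subset_iff)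
    qed fact
    then show ?thesis by simp
  qed
  then show ?thesis
    by (simp add: lipschitz1_def mcshane_def)
qed

end

text \<open>
  The formula involves nothing but the metric and \<open>Z\<close>, so it commutes with every isometry
  that preserves \<open>Z\<close>.  This is what makes McShane's extension an equivariant section.
\<close>

lemma mcshane_equivariant:
  assumes "\<psi> ` Z = Z" and "Z \<subseteq> X" and "\<And>x. x \<in> X \<Longrightarrow> \<psi> x \<in> X"
    and "\<And>x y. x \<in> X \<Longrightarrow> y \<in> X \<Longrightarrow> d (\<psi> x) (\<psi> y) = d x y"
  shows "mcshane Z X d (\<lambda>z. f (\<psi> z)) = (\<lambda>x\<in>X. mcshane Z X d f (\<psi> x))"
proof
  fix x
  show "mcshane Z X d (\<lambda>z. f (\<psi> z)) x = (\<lambda>x\<in>X. mcshane Z X d f (\<psi> x)) x"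
  proof (cases "x \<in> X")
    case True
    have "(INF z\<in>Z. f (\<psi> z) + d z x) = (INF z\<in>Z. f (\<psi> z) + d (\<psi> z) (\<psi> x))"
      using assms(2,4) True by (intro INF_cong) auto
    also have "\<dots> = (INF z\<in>\<psi> ` Z. f z + d z (\<psi> x))"
      by (simp add: image_image)
    finally show ?thesis
      using True assms(1,3) by (simp add: mcshane_def)
  qed (simp add: mcshane_def)
qed

lemma mcshane_cong:
  "(\<And>z. z \<in> Z \<Longrightarrow> f z = g z) \<Longrightarrow> mcshane Z X d f = mcshane Z X d g"
  by (simp add: mcshane_def cong: INF_cong)

text \<open>
  Precomposition turns the left action on points into a right action on functions.
\<close>

definition translate :: "('g \<Rightarrow> 'x \<Rightarrow> 'x) \<Rightarrow> 'x set \<Rightarrow> 'g \<Rightarrow> ('x \<Rightarrow> real) \<Rightarrow> 'x \<Rightarrow> real"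
  where "translate \<phi> X g f = (\<lambda>x\<in>X. f (\<phi> g x))"

lemma translate_lipschitz1:
  assumes "isometric_action G X d \<phi>" "g \<in> carrier G" "f \<in> lipschitz1 X d"
  shows "translate \<phi> X g f \<in> lipschitz1 X d"
  unfolding translate_def lipschitz1_def
proof safe
  fix x y assume xy: "x \<in> X" "y \<in> X"
  then have "f (\<phi> g x) \<le> f (\<phi> g y) + d (\<phi> g x) (\<phi> g y)"
    using assms(3) isometric_actionD(2)[OF assms(1,2)] by (simp add: lipschitz1_def)
  then show "(\<lambda>x\<in>X. f (\<phi> g x)) x \<le> (\<lambda>x\<in>X. f (\<phi> g x)) y + d x y"
    using isometric_actionD(5)[OF assms(1,2)] xy by simp
qed simp

lemma translate_one:
  assumes "isometric_action G X d \<phi>" "f \<in> lipschitz1 X d"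
  shows "translate \<phi> X \<one>\<^bsub>G\<^esub> f = f"
  using assms(2) isometric_actionD(3)[OF assms(1)]
  by (auto simp: translate_def lipschitz1_def extensional_def)

lemma translate_mult:
  assumes "isometric_action G X d \<phi>" "g \<in> carrier G" "h \<in> carrier G"
  shows "translate \<phi> X (g \<otimes>\<^bsub>G\<^esub> h) f = translate \<phi> X h (translate \<phi> X g f)"
  using assms(2,3) isometric_actionD(2,4)[OF assms(1)]
  by (auto simp: translate_def)

lemma mcshane_translate:
  assumes act: "isometric_action G X d \<phi>" and h: "h \<in> carrier G"
    and Z: "Z \<subseteq> X" "\<phi> h ` Z = Z"
    and eq: "\<And>z. z \<in> Z \<Longrightarrow> f' z = f (\<phi> h z)"
  shows "mcshane Z X d f' = translate \<phi> X h (mcshane Z X d f)"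
proof -
  have "mcshane Z X d f' = mcshane Z X d (\<lambda>z. f (\<phi> h z))"
    by (rule mcshane_cong) (rule eq)
  also have "\<dots> = translate \<phi> X h (mcshane Z X d f)"
    unfolding translate_def
    by (rule mcshane_equivariant) (use Z h isometric_actionD[OF act] in auto)
  finally show ?thesis .
qed

lemma dist_lipschitz1:
  assumes "Metric_space X d" "x \<in> X"
  shows "(\<lambda>y\<in>X. d x y) \<in> lipschitz1 X d"
proof -
  interpret Metric_space X d by fact
  show ?thesis
    using triangle[of x] assms(2) by (simp add: lipschitz1_def) (metis add.commute commute)
qed

section \<open>Actions of amalgamated products\<close>

lemma amalg_prod_carrier: "carrier (amalg_prod G1 G0 G2) = amalg_words G1 G2 // amalg_rel G1 G0 G2"
  by (simp add: amalg_prod_def)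

lemma amalg_prod_induct [consumes 1, case_names one incl1 incl2]:
  assumes "A \<in> carrier (amalg_prod G1 G0 G2)"
    and one: "P \<one>\<^bsub>amalg_prod G1 G0 G2\<^esub>"
    and 1: "\<And>g A. g \<in> carrier G1 \<Longrightarrow> A \<in> carrier (amalg_prod G1 G0 G2) \<Longrightarrow> P A
      \<Longrightarrow> P (amalg_incl1 G1 G0 G2 g \<otimes>\<^bsub>amalg_prod G1 G0 G2\<^esub> A)"
    and 2: "\<And>g A. g \<in> carrier G2 \<Longrightarrow> A \<in> carrier (amalg_prod G1 G0 G2) \<Longrightarrow> P A
      \<Longrightarrow> P (amalg_incl2 G1 G0 G2 g \<otimes>\<^bsub>amalg_prod G1 G0 G2\<^esub> A)"
  shows "P A"
proof -
  have "P (amalg_rel G1 G0 G2 `` {w})" if "w \<in> amalg_words G1 G2" for w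
    using that unfolding amalg_words_def
  proof (induction w rule: lists.induct)
    case Nil
    show ?case using one by (simp add: amalg_prod_def)
  next
    case (Cons a w)
    then have w: "w \<in> amalg_words G1 G2" and a: "[a] \<in> amalg_words G1 G2"
      by (auto simp: amalg_words_def)
    then have car: "amalg_rel G1 G0 G2 `` {w} \<in> carrier (amalg_prod G1 G0 G2)"
      by (simp add: amalg_prod_carrier quotientI)
    show ?case
      using \<open>a \<in> carrier G1 <+> carrier G2\<close>
    proof (elim PlusE)
      fix g assume "g \<in> carrier G1" "a = Inl g"
      then show ?thesis
        using 1[OF _ car Cons.IH, of g] amalg_mult_class[OF a w, of G0] by (simp add: amalg_incl1_def)
    next
      fix g assume "g \<in> carrier G2" "a = Inr g"
      then show ?thesis
        using 2[OF _ car Cons.IH, of g] amalg_mult_class[OF a w, of G0] by (simp add: amalg_incl2_def)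
    qed
  qed
  then show ?thesis
    using assms(1) by (auto simp: amalg_prod_carrier elim: quotientE)
qed

text \<open>
  The universal property of the amalgamated product, for right actions: a word acts letter by
  letter, and each of the generating relations holds in the action.
\<close>

lemma amalg_prod_right_action:
  fixes \<alpha>1 \<alpha>2 :: "'g \<Rightarrow> 'w \<Rightarrow> 'w"
  assumes cl1: "\<And>g \<omega>. g \<in> carrier G1 \<Longrightarrow> \<omega> \<in> \<Omega> \<Longrightarrow> \<alpha>1 g \<omega> \<in> \<Omega>"
    and one1: "\<And>\<omega>. \<omega> \<in> \<Omega> \<Longrightarrow> \<alpha>1 \<one>\<^bsub>G1\<^esub> \<omega> = \<omega>"
    and mult1: "\<And>g h \<omega>. g \<in> carrier G1 \<Longrightarrow> h \<in> carrier G1 \<Longrightarrow> \<omega> \<in> \<Omega>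
      \<Longrightarrow> \<alpha>1 (g \<otimes>\<^bsub>G1\<^esub> h) \<omega> = \<alpha>1 h (\<alpha>1 g \<omega>)"
    and cl2: "\<And>g \<omega>. g \<in> carrier G2 \<Longrightarrow> \<omega> \<in> \<Omega> \<Longrightarrow> \<alpha>2 g \<omega> \<in> \<Omega>"
    and one2: "\<And>\<omega>. \<omega> \<in> \<Omega> \<Longrightarrow> \<alpha>2 \<one>\<^bsub>G2\<^esub> \<omega> = \<omega>"
    and mult2: "\<And>g h \<omega>. g \<in> carrier G2 \<Longrightarrow> h \<in> carrier G2 \<Longrightarrow> \<omega> \<in> \<Omega>
      \<Longrightarrow> \<alpha>2 (g \<otimes>\<^bsub>G2\<^esub> h) \<omega> = \<alpha>2 h (\<alpha>2 g \<omega>)"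
    and agree: "\<And>h \<omega>. h \<in> G0 \<Longrightarrow> \<omega> \<in> \<Omega> \<Longrightarrow> \<alpha>1 h \<omega> = \<alpha>2 h \<omega>"
  obtains \<beta> :: "('g + 'g) list set \<Rightarrow> 'w \<Rightarrow> 'w" where
    "\<And>A \<omega>. A \<in> carrier (amalg_prod G1 G0 G2) \<Longrightarrow> \<omega> \<in> \<Omega> \<Longrightarrow> \<beta> A \<omega> \<in> \<Omega>"
    "\<And>\<omega>. \<omega> \<in> \<Omega> \<Longrightarrow> \<beta> \<one>\<^bsub>amalg_prod G1 G0 G2\<^esub> \<omega> = \<omega>"
    "\<And>A B \<omega>. A \<in> carrier (amalg_prod G1 G0 G2) \<Longrightarrow> B \<in> carrier (amalg_prod G1 G0 G2) \<Longrightarrow> \<omega> \<in> \<Omega>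
      \<Longrightarrow> \<beta> (A \<otimes>\<^bsub>amalg_prod G1 G0 G2\<^esub> B) \<omega> = \<beta> B (\<beta> A \<omega>)"
    "\<And>g \<omega>. g \<in> carrier G1 \<Longrightarrow> \<omega> \<in> \<Omega> \<Longrightarrow> \<beta> (amalg_incl1 G1 G0 G2 g) \<omega> = \<alpha>1 g \<omega>"
    "\<And>g \<omega>. g \<in> carrier G2 \<Longrightarrow> \<omega> \<in> \<Omega> \<Longrightarrow> \<beta> (amalg_incl2 G1 G0 G2 g) \<omega> = \<alpha>2 g \<omega>"
proof -
  let ?R = "amalg_rel G1 G0 G2" and ?W = "amalg_words G1 G2" and ?P = "amalg_prod G1 G0 G2"
  define run where "run = foldl (\<lambda>\<omega>. case_sum (\<lambda>g. \<alpha>1 g \<omega>) (\<lambda>g. \<alpha>2 g \<omega>))"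
  have run_simps: "run \<omega> [] = \<omega>" "run \<omega> (x # w) = run (case_sum (\<lambda>g. \<alpha>1 g \<omega>) (\<lambda>g. \<alpha>2 g \<omega>) x) w"
    "run \<omega> (u @ v) = run (run \<omega> u) v" for \<omega> x w u v
    by (simp_all add: run_def)
  have run_in: "run \<omega> w \<in> \<Omega>" if "w \<in> ?W" "\<omega> \<in> \<Omega>" for w \<omega>
    using that(1)[unfolded amalg_words_def] that(2)
    by (induction w arbitrary: \<omega> rule: lists.induct) (auto simp: run_simps cl1 cl2)
  have run_rel: "run \<omega> u = run \<omega> v" if "(u, v) \<in> ?R" "\<omega> \<in> \<Omega>" for u v \<omega>
    using that
  proof (induction arbitrary: \<omega> rule: amalg_rel.induct)
    case (append u u' v v')
    then show ?case
      using run_in amalg_rel_words[OF append(1)] by (simp add: run_simps)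
  qed (simp_all add: run_simps one1 one2 mult1 mult2 agree)
  define \<beta> where "\<beta> A \<omega> = run \<omega> (SOME w. w \<in> A)" for A \<omega>
  have \<beta>: "\<beta> (?R `` {w}) \<omega> = run \<omega> w" if "w \<in> ?W" "\<omega> \<in> \<Omega>" for w \<omega>
  proof -
    have "(SOME v. v \<in> ?R `` {w}) \<in> ?R `` {w}"
      by (rule someI[of _ w]) (simp add: amalg_rel.refl that)
    then show ?thesis
      using run_rel that by (simp add: \<beta>_def)
  qed
  have ex: "\<exists>w\<in>?W. A = ?R `` {w}" if "A \<in> carrier ?P" for A
    using that by (auto simp: amalg_prod_carrier elim: quotientE)
  have app: "u @ v \<in> ?W" if "u \<in> ?W" "v \<in> ?W" for u v
    using that by (simp add: amalg_words_def)
  show ?thesis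
  proof (rule that[of \<beta>])
    fix A \<omega> assume "A \<in> carrier ?P" and \<omega>: "\<omega> \<in> \<Omega>"
    from ex[OF this(1)] obtain u where u: "u \<in> ?W" "A = ?R `` {u}" by blast
    then show "\<beta> A \<omega> \<in> \<Omega>" using \<beta> \<omega> run_in by simp
    fix B assume "B \<in> carrier ?P"
    from ex[OF this(1)] obtain v where v: "v \<in> ?W" "B = ?R `` {v}" by blast
    show "\<beta> (A \<otimes>\<^bsub>?P\<^esub> B) \<omega> = \<beta> B (\<beta> A \<omega>)"
      unfolding u(2) v(2) amalg_mult_class[OF u(1) v(1)]
      using u v \<omega> by (simp add: \<beta> app run_in run_simps)
  next
    fix \<omega> assume "\<omega> \<in> \<Omega>"
    then show "\<beta> \<one>\<^bsub>?P\<^esub> \<omega> = \<omega>"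
      using \<beta>[of "[]"] by (simp add: amalg_prod_def amalg_words_def run_simps)
  next
    fix g \<omega> assume "g \<in> carrier G1" "\<omega> \<in> \<Omega>"
    then show "\<beta> (amalg_incl1 G1 G0 G2 g) \<omega> = \<alpha>1 g \<omega>"
      using \<beta>[of "[Inl g]" \<omega>] by (auto simp: amalg_incl1_def amalg_words_def run_simps)
  next
    fix g \<omega> assume "g \<in> carrier G2" "\<omega> \<in> \<Omega>"
    then show "\<beta> (amalg_incl2 G1 G0 G2 g) \<omega> = \<alpha>2 g \<omega>"
      using \<beta>[of "[Inr g]" \<omega>] by (auto simp: amalg_incl2_def amalg_words_def run_simps)
  qed
qed

section \<open>The invariant pseudometric\<close>

locale amalgamation_problem =
  fixes G1 G2 :: "'g monoid" and G0 :: "'g set"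
    and X0 X1 X2 :: "'x set"
    and d1 d2 :: "'x \<Rightarrow> 'x \<Rightarrow> real"
    and \<phi>1 \<phi>2 :: "'g \<Rightarrow> 'x \<Rightarrow> 'x"
  assumes G1: "group G1" and G2: "group G2"
    and G0: "subgroup G0 G1" "subgroup G0 G2"
    and mult_agree: "\<And>g h. g \<in> G0 \<Longrightarrow> h \<in> G0 \<Longrightarrow> g \<otimes>\<^bsub>G1\<^esub> h = g \<otimes>\<^bsub>G2\<^esub> h"
    and act1: "isometric_action G1 X1 d1 \<phi>1" and act2: "isometric_action G2 X2 d2 \<phi>2"
    and X0: "X0 \<subseteq> X1" "X0 \<subseteq> X2" "X0 \<noteq> {}"
    and dist_agree: "\<And>x y. x \<in> X0 \<Longrightarrow> y \<in> X0 \<Longrightarrow> d1 x y = d2 x y"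
    and X0_invariant: "\<And>g x. g \<in> G0 \<Longrightarrow> x \<in> X0 \<Longrightarrow> \<phi>1 g x \<in> X0"
    and act_agree: "\<And>g x. g \<in> G0 \<Longrightarrow> x \<in> X0 \<Longrightarrow> \<phi>1 g x = \<phi>2 g x"
begin

abbreviation "P \<equiv> amalg_prod G1 G0 G2"
abbreviation "\<iota>1 \<equiv> amalg_incl1 G1 G0 G2"
abbreviation "\<iota>2 \<equiv> amalg_incl2 G1 G0 G2"

sublocale P: group P
  by (rule group_amalg_prod[OF G1 G2])

lemma incl_closed [simp]:
  "g \<in> carrier G1 \<Longrightarrow> \<iota>1 g \<in> carrier P" "g \<in> carrier G2 \<Longrightarrow> \<iota>2 g \<in> carrier P"
  using amalg_incl1_hom[OF G1 G2, of G0] amalg_incl2_hom[OF G1 G2, of G0] by (auto simp: hom_def)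

lemma one_agree: "\<one>\<^bsub>G1\<^esub> = \<one>\<^bsub>G2\<^esub>"
proof -
  interpret G1: group G1 by (rule G1)
  interpret G2: group G2 by (rule G2)
  have "\<one>\<^bsub>G1\<^esub> \<in> G0"
    using G0(1) by (rule subgroup.one_closed)
  then have "\<one>\<^bsub>G1\<^esub> \<otimes>\<^bsub>G2\<^esub> \<one>\<^bsub>G1\<^esub> = \<one>\<^bsub>G1\<^esub>" "\<one>\<^bsub>G1\<^esub> \<in> carrier G2"
    using mult_agree[of "\<one>\<^bsub>G1\<^esub>" "\<one>\<^bsub>G1\<^esub>"] subgroup.mem_carrier[OF G0(2)] by auto
  then show ?thesis
    using G2.l_cancel_one by blast
qed

lemma G0_carrier: "h \<in> G0 \<Longrightarrow> h \<in> carrier G1" "h \<in> G0 \<Longrightarrow> h \<in> carrier G2"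
  using G0 by (auto dest: subgroup.mem_carrier)

lemma X0_image:
  assumes h: "h \<in> G0"
  shows "\<phi>1 h ` X0 = X0" "\<phi>2 h ` X0 = X0"
proof -
  interpret G1: group G1 by (rule G1)
  have "x \<in> \<phi>1 h ` X0" if x: "x \<in> X0" for x
  proof
    have h': "inv\<^bsub>G1\<^esub> h \<in> G0" using h G0(1) subgroup.m_inv_closed by metis
    show "\<phi>1 (inv\<^bsub>G1\<^esub> h) x \<in> X0" using X0_invariant[OF h' x] .
    show "x = \<phi>1 h (\<phi>1 (inv\<^bsub>G1\<^esub> h) x)"
      using isometric_actionD(4)[OF act1, of h "inv\<^bsub>G1\<^esub> h" x] isometric_actionD(3)[OF act1, of x]
        G0_carrier(1)[OF h] x X0 by auto
  qed
  then show 1: "\<phi>1 h ` X0 = X0"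
    using X0_invariant[OF h] by auto
  then show "\<phi>2 h ` X0 = X0"
    using act_agree[OF h] by (simp cong: image_cong)
qed

lemma lipschitz1_on_X0:
  assumes "f \<in> lipschitz1 X1 d1 \<or> f \<in> lipschitz1 X2 d2" "z \<in> X0" "w \<in> X0"
  shows "f z \<le> f w + d1 z w" "f z \<le> f w + d2 z w"
proof -
  have "f z \<le> f w + d1 z w \<or> f z \<le> f w + d2 z w"
    using assms X0 by (auto simp: lipschitz1_def subset_iff)
  then show "f z \<le> f w + d1 z w" "f z \<le> f w + d2 z w"
    using dist_agree[OF assms(2,3)] by auto
qed

text \<open>
  The states with their right action \<open>\<beta>\<close>.  The actions of \<open>G1\<close> and \<open>G2\<close> come from \<open>free_extension\<close>
  with \<open>r\<close> the first or the second projection of a pair, and McShane's extension of the remaining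
  component as section.  They agree on \<open>G0\<close>, where both are right multiplication on the last factor.
\<close>

lemma value_system:
  obtains \<Omega> :: "((('x \<Rightarrow> real) \<times> ('x \<Rightarrow> real)) \<times> ((('x \<Rightarrow> real) \<times> ('x \<Rightarrow> real)) \<times> 'g) list \<times> 'g) set"
    and \<beta> and v1 v2 where
    "\<And>A \<omega>. A \<in> carrier P \<Longrightarrow> \<omega> \<in> \<Omega> \<Longrightarrow> \<beta> A \<omega> \<in> \<Omega>"
    "\<And>\<omega>. \<omega> \<in> \<Omega> \<Longrightarrow> \<beta> \<one>\<^bsub>P\<^esub> \<omega> = \<omega>"
    "\<And>A B \<omega>. A \<in> carrier P \<Longrightarrow> B \<in> carrier P \<Longrightarrow> \<omega> \<in> \<Omega> \<Longrightarrow> \<beta> (A \<otimes>\<^bsub>P\<^esub> B) \<omega> = \<beta> B (\<beta> A \<omega>)"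
    "\<And>\<omega>. \<omega> \<in> \<Omega> \<Longrightarrow> v1 \<omega> \<in> lipschitz1 X1 d1"
    "\<And>\<omega>. \<omega> \<in> \<Omega> \<Longrightarrow> v2 \<omega> \<in> lipschitz1 X2 d2"
    "\<And>\<omega> z. \<omega> \<in> \<Omega> \<Longrightarrow> z \<in> X0 \<Longrightarrow> v1 \<omega> z = v2 \<omega> z"
    "\<And>g \<omega> x. g \<in> carrier G1 \<Longrightarrow> \<omega> \<in> \<Omega> \<Longrightarrow> x \<in> X1 \<Longrightarrow> v1 (\<beta> (\<iota>1 g) \<omega>) x = v1 \<omega> (\<phi>1 g x)"
    "\<And>g \<omega> x. g \<in> carrier G2 \<Longrightarrow> \<omega> \<in> \<Omega> \<Longrightarrow> x \<in> X2 \<Longrightarrow> v2 (\<beta> (\<iota>2 g) \<omega>) x = v2 \<omega> (\<phi>2 g x)"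
    "\<And>f. f \<in> lipschitz1 X1 d1 \<Longrightarrow> \<exists>\<omega>\<in>\<Omega>. v1 \<omega> = f"
    "\<And>f. f \<in> lipschitz1 X2 d2 \<Longrightarrow> \<exists>\<omega>\<in>\<Omega>. v2 \<omega> = f"
proof -
  note M1 = isometric_actionD(1)[OF act1] and M2 = isometric_actionD(1)[OF act2]
  let ?L1 = "lipschitz1 X1 d1" and ?L2 = "lipschitz1 X2 d2"
  define B where "B = {(f1, f2). f1 \<in> ?L1 \<and> f2 \<in> ?L2 \<and> (\<forall>z\<in>X0. f1 z = f2 z)}"
  define a where "a h b = (translate \<phi>1 X1 h (fst b), translate \<phi>2 X2 h (snd b))" for h b
  \<comment> \<open>Two equivariant sections: extend a function from \<open>X1\<close> to \<open>X2\<close>, or the other way round,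
    through its restriction to \<open>X0\<close>.\<close>
  define s1 where "s1 f = (f, mcshane X0 X2 d2 f)" for f
  define s2 where "s2 f = (mcshane X0 X1 d1 f, f)" for f
  have a_B: "a h b \<in> B" if "h \<in> G0" "b \<in> B" for h b
    using that X0 translate_lipschitz1[OF act1 G0_carrier(1)] translate_lipschitz1[OF act2 G0_carrier(2)]
    by (auto simp: a_def B_def translate_def subset_iff X0_invariant act_agree[symmetric])
  have a_one: "a \<one>\<^bsub>G1\<^esub> b = b" "a \<one>\<^bsub>G2\<^esub> b = b" if "b \<in> B" for b
    using that translate_one[OF act1, of "fst b"] translate_one[OF act2, of "snd b"]
    by (auto simp: a_def B_def one_agree)
  have a_mult: "a (h \<otimes>\<^bsub>G1\<^esub> k) b = a k (a h b)" "a (h \<otimes>\<^bsub>G2\<^esub> k) b = a k (a h b)"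
    if "h \<in> G0" "k \<in> G0" for h k b
    using that translate_mult[OF act1 G0_carrier(1) G0_carrier(1), of h k]
      translate_mult[OF act2 G0_carrier(2) G0_carrier(2), of h k]
    by (auto simp: a_def mult_agree)
  have s1_B: "s1 f \<in> B" if "f \<in> ?L1" for f
    using that mcshane_lipschitz1[OF M2 X0(2,3), of f] mcshane_extends[OF M2 X0(2,3), of f]
      lipschitz1_on_X0[of f]
    by (auto simp: s1_def B_def)
  have s2_B: "s2 f \<in> B" if "f \<in> ?L2" for f
    using that mcshane_lipschitz1[OF M1 X0(1,3), of f] mcshane_extends[OF M1 X0(1,3), of f]
      lipschitz1_on_X0[of f]
    by (auto simp: s2_def B_def)
  have s1_a: "s1 (translate \<phi>1 X1 h f) = a h (s1 f)" if "h \<in> G0" for h f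
    using that X0 mcshane_translate[OF act2 G0_carrier(2) X0(2) X0_image(2),
        of h "translate \<phi>1 X1 h f" f]
    by (auto simp: s1_def a_def translate_def act_agree subset_iff)
  have s2_a: "s2 (translate \<phi>2 X2 h f) = a h (s2 f)" if "h \<in> G0" for h f
    using that X0 mcshane_translate[OF act1 G0_carrier(1) X0(1) X0_image(1),
        of h "translate \<phi>2 X2 h f" f]
    by (auto simp: s2_def a_def translate_def act_agree subset_iff)

  \<comment> \<open>Lists provide an infinite type into which both \<open>B \<times> G1\<close> and \<open>B \<times> G2\<close> inject.\<close>
  let ?N = "UNIV :: ((('x \<Rightarrow> real) \<times> ('x \<Rightarrow> real)) \<times> 'g) list set"
  let ?\<Omega> = "B \<times> ?N \<times> G0"
  have N: "infinite ?N"
    by (rule infinite_UNIV_listI)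
  have N1: "|B \<times> carrier G1| \<le>o |?N|" and N2: "|B \<times> carrier G2| \<le>o |?N|"
    by (rule card_of_ordLeqI[of "\<lambda>x. [x]"]; auto simp: inj_on_def)+
  obtain \<alpha>1 :: "'g \<Rightarrow> _ \<times> ((('x \<Rightarrow> real) \<times> ('x \<Rightarrow> real)) \<times> 'g) list \<times> 'g \<Rightarrow> _" where \<alpha>1:
    "\<And>g \<omega>. g \<in> carrier G1 \<Longrightarrow> \<omega> \<in> ?\<Omega> \<Longrightarrow> \<alpha>1 g \<omega> \<in> ?\<Omega>"
    "\<And>g h \<omega>. g \<in> carrier G1 \<Longrightarrow> h \<in> carrier G1 \<Longrightarrow> \<omega> \<in> ?\<Omega>
      \<Longrightarrow> \<alpha>1 (g \<otimes>\<^bsub>G1\<^esub> h) \<omega> = \<alpha>1 h (\<alpha>1 g \<omega>)"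
    "\<And>h b n k. h \<in> G0 \<Longrightarrow> b \<in> B \<Longrightarrow> k \<in> G0 \<Longrightarrow> \<alpha>1 h (b, n, k) = (b, n, k \<otimes>\<^bsub>G1\<^esub> h)"
    "\<And>g \<omega>. g \<in> carrier G1 \<Longrightarrow> \<omega> \<in> ?\<Omega> \<Longrightarrow> fst (case \<alpha>1 g \<omega> of (b, n, k) \<Rightarrow> a k b)
      = translate \<phi>1 X1 g (fst (case \<omega> of (b, n, k) \<Rightarrow> a k b))"
  proof (rule free_extension[OF G1 G0(1), of B a ?L1 "translate \<phi>1 X1" fst s1, OF _ _ _ _ _ _ _ _ _ _ N N1])
    show "f \<in> ?L1 \<Longrightarrow> fst (s1 f) = f" for f by (simp add: s1_def)
    show "b \<in> B \<Longrightarrow> fst b \<in> ?L1" for b by (auto simp: B_def)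
    show "fst (a h b) = translate \<phi>1 X1 h (fst b)" for h b by (simp add: a_def)
  qed (assumption | rule a_B a_one(1) a_mult(1) s1_B s1_a translate_lipschitz1[OF act1]
      translate_mult[OF act1] that)+
  obtain \<alpha>2 :: "'g \<Rightarrow> _ \<times> ((('x \<Rightarrow> real) \<times> ('x \<Rightarrow> real)) \<times> 'g) list \<times> 'g \<Rightarrow> _" where \<alpha>2:
    "\<And>g \<omega>. g \<in> carrier G2 \<Longrightarrow> \<omega> \<in> ?\<Omega> \<Longrightarrow> \<alpha>2 g \<omega> \<in> ?\<Omega>"
    "\<And>g h \<omega>. g \<in> carrier G2 \<Longrightarrow> h \<in> carrier G2 \<Longrightarrow> \<omega> \<in> ?\<Omega>
      \<Longrightarrow> \<alpha>2 (g \<otimes>\<^bsub>G2\<^esub> h) \<omega> = \<alpha>2 h (\<alpha>2 g \<omega>)"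
    "\<And>h b n k. h \<in> G0 \<Longrightarrow> b \<in> B \<Longrightarrow> k \<in> G0 \<Longrightarrow> \<alpha>2 h (b, n, k) = (b, n, k \<otimes>\<^bsub>G2\<^esub> h)"
    "\<And>g \<omega>. g \<in> carrier G2 \<Longrightarrow> \<omega> \<in> ?\<Omega> \<Longrightarrow> snd (case \<alpha>2 g \<omega> of (b, n, k) \<Rightarrow> a k b)
      = translate \<phi>2 X2 g (snd (case \<omega> of (b, n, k) \<Rightarrow> a k b))"
  proof (rule free_extension[OF G2 G0(2), of B a ?L2 "translate \<phi>2 X2" snd s2, OF _ _ _ _ _ _ _ _ _ _ N N2])
    show "f \<in> ?L2 \<Longrightarrow> snd (s2 f) = f" for f by (simp add: s2_def)
    show "b \<in> B \<Longrightarrow> snd b \<in> ?L2" for b by (auto simp: B_def)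
    show "snd (a h b) = translate \<phi>2 X2 h (snd b)" for h b by (simp add: a_def)
  qed (assumption | rule a_B a_one(2) a_mult(2) s2_B s2_a translate_lipschitz1[OF act2]
      translate_mult[OF act2] that)+

  have one0: "\<one>\<^bsub>G1\<^esub> \<in> G0" "\<one>\<^bsub>G2\<^esub> \<in> G0"
    using G0 by (auto intro: subgroup.one_closed)
  have \<alpha>_one: "\<alpha>1 \<one>\<^bsub>G1\<^esub> \<omega> = \<omega>" "\<alpha>2 \<one>\<^bsub>G2\<^esub> \<omega> = \<omega>" if "\<omega> \<in> ?\<Omega>" for \<omega>
    using that \<alpha>1(3)[OF one0(1)] \<alpha>2(3)[OF one0(2)] G0_carrier
      monoid.r_one[OF group.is_monoid[OF G1]] monoid.r_one[OF group.is_monoid[OF G2]] by auto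
  have \<alpha>_agree: "\<alpha>1 h \<omega> = \<alpha>2 h \<omega>" if "h \<in> G0" "\<omega> \<in> ?\<Omega>" for h \<omega>
    using that \<alpha>1(3)[OF that(1)] \<alpha>2(3)[OF that(1)] by (auto simp: mult_agree)
  obtain \<beta> where \<beta>:
    "\<And>A \<omega>. A \<in> carrier P \<Longrightarrow> \<omega> \<in> ?\<Omega> \<Longrightarrow> \<beta> A \<omega> \<in> ?\<Omega>"
    "\<And>\<omega>. \<omega> \<in> ?\<Omega> \<Longrightarrow> \<beta> \<one>\<^bsub>P\<^esub> \<omega> = \<omega>"
    "\<And>A B \<omega>. A \<in> carrier P \<Longrightarrow> B \<in> carrier P \<Longrightarrow> \<omega> \<in> ?\<Omega> \<Longrightarrow> \<beta> (A \<otimes>\<^bsub>P\<^esub> B) \<omega> = \<beta> B (\<beta> A \<omega>)"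
    "\<And>g \<omega>. g \<in> carrier G1 \<Longrightarrow> \<omega> \<in> ?\<Omega> \<Longrightarrow> \<beta> (\<iota>1 g) \<omega> = \<alpha>1 g \<omega>"
    "\<And>g \<omega>. g \<in> carrier G2 \<Longrightarrow> \<omega> \<in> ?\<Omega> \<Longrightarrow> \<beta> (\<iota>2 g) \<omega> = \<alpha>2 g \<omega>"
    by (rule amalg_prod_right_action[where \<Omega> = ?\<Omega>, OF \<alpha>1(1) \<alpha>_one(1) \<alpha>1(2) \<alpha>2(1) \<alpha>_one(2) \<alpha>2(2) \<alpha>_agree])
      (assumption | rule that)+
  define v where "v = (\<lambda>(b, n :: ((('x \<Rightarrow> real) \<times> ('x \<Rightarrow> real)) \<times> 'g) list, k). a k b)"
  have v_B: "v \<omega> \<in> B" if "\<omega> \<in> ?\<Omega>" for \<omega>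
    using that a_B by (auto simp: v_def)
  have v_hit: "\<exists>\<omega>\<in>?\<Omega>. v \<omega> = b" if "b \<in> B" for b
    using that one0 a_one by (intro bexI[of _ "(b, [], \<one>\<^bsub>G1\<^esub>)"]) (auto simp: v_def)
  show ?thesis
  proof (rule that[of ?\<Omega> \<beta> "\<lambda>\<omega>. fst (v \<omega>)" "\<lambda>\<omega>. snd (v \<omega>)"])
    fix g \<omega> x assume "g \<in> carrier G1" "\<omega> \<in> ?\<Omega>" "x \<in> X1"
    then show "fst (v (\<beta> (\<iota>1 g) \<omega>)) x = fst (v \<omega>) (\<phi>1 g x)"
      using \<alpha>1(4)[of g \<omega>] \<beta>(4)[of g \<omega>] by (simp add: v_def translate_def)
  next
    fix g \<omega> x assume "g \<in> carrier G2" "\<omega> \<in> ?\<Omega>" "x \<in> X2"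
    then show "snd (v (\<beta> (\<iota>2 g) \<omega>)) x = snd (v \<omega>) (\<phi>2 g x)"
      using \<alpha>2(4)[of g \<omega>] \<beta>(5)[of g \<omega>] by (simp add: v_def translate_def)
  next
    fix f assume "f \<in> ?L1"
    from v_hit[OF s1_B[OF this]] show "\<exists>\<omega>\<in>?\<Omega>. fst (v \<omega>) = f"
      by (metis s1_def fst_conv)
  next
    fix f assume "f \<in> ?L2"
    from v_hit[OF s2_B[OF this]] show "\<exists>\<omega>\<in>?\<Omega>. snd (v \<omega>) = f"
      by (metis s2_def snd_conv)
  qed (use \<beta>(1-3) v_B in \<open>auto simp: B_def split_beta\<close>)
qed

text \<open>
  In the state \<open>\<omega>\<close>, the point \<open>(A, x)\<close> is given the value that the function attached to the state
  \<open>\<omega> \<cdot> A\<close> takes at \<open>x\<close>.  As the states carry a right action, left translation of points by \<open>C\<close> merely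
  permutes the states.
\<close>

lemma amalgam_pseudometric:
  obtains p :: "('g + 'g) list set \<times> ('x + 'x) \<Rightarrow> ('g + 'g) list set \<times> ('x + 'x) \<Rightarrow> real" where
    "\<And>s t. s \<in> carrier P \<times> (X1 <+> X2) \<Longrightarrow> t \<in> carrier P \<times> (X1 <+> X2) \<Longrightarrow> 0 \<le> p s t"
    "\<And>s. p s s = 0"
    "\<And>s t. p s t = p t s"
    "\<And>s t u. s \<in> carrier P \<times> (X1 <+> X2) \<Longrightarrow> t \<in> carrier P \<times> (X1 <+> X2)
      \<Longrightarrow> u \<in> carrier P \<times> (X1 <+> X2) \<Longrightarrow> p s u \<le> p s t + p t u"
    "\<And>A B C x y. A \<in> carrier P \<Longrightarrow> B \<in> carrier P \<Longrightarrow> C \<in> carrier P \<Longrightarrow> x \<in> X1 <+> X2 \<Longrightarrow> y \<in> X1 <+> X2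
      \<Longrightarrow> p (A \<otimes>\<^bsub>P\<^esub> B, x) (A \<otimes>\<^bsub>P\<^esub> C, y) = p (B, x) (C, y)"
    "\<And>x y. x \<in> X1 \<Longrightarrow> y \<in> X1 \<Longrightarrow> p (\<one>\<^bsub>P\<^esub>, Inl x) (\<one>\<^bsub>P\<^esub>, Inl y) = d1 x y"
    "\<And>x y. x \<in> X2 \<Longrightarrow> y \<in> X2 \<Longrightarrow> p (\<one>\<^bsub>P\<^esub>, Inr x) (\<one>\<^bsub>P\<^esub>, Inr y) = d2 x y"
    "\<And>z. z \<in> X0 \<Longrightarrow> p (\<one>\<^bsub>P\<^esub>, Inl z) (\<one>\<^bsub>P\<^esub>, Inr z) = 0"
    "\<And>g x. g \<in> carrier G1 \<Longrightarrow> x \<in> X1 \<Longrightarrow> p (\<iota>1 g, Inl x) (\<one>\<^bsub>P\<^esub>, Inl (\<phi>1 g x)) = 0"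
    "\<And>g x. g \<in> carrier G2 \<Longrightarrow> x \<in> X2 \<Longrightarrow> p (\<iota>2 g, Inr x) (\<one>\<^bsub>P\<^esub>, Inr (\<phi>2 g x)) = 0"
proof -
  let ?S = "carrier P \<times> (X1 <+> X2)"
  interpret M1: Metric_space X1 d1 by (rule isometric_actionD(1)[OF act1])
  interpret M2: Metric_space X2 d2 by (rule isometric_actionD(1)[OF act2])
  obtain \<Omega> :: "((('x \<Rightarrow> real) \<times> ('x \<Rightarrow> real)) \<times> ((('x \<Rightarrow> real) \<times> ('x \<Rightarrow> real)) \<times> 'g) list \<times> 'g) set"
      and \<beta> and v1 v2 where
    \<beta>: "\<And>A \<omega>. A \<in> carrier P \<Longrightarrow> \<omega> \<in> \<Omega> \<Longrightarrow> \<beta> A \<omega> \<in> \<Omega>"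
    "\<And>\<omega>. \<omega> \<in> \<Omega> \<Longrightarrow> \<beta> \<one>\<^bsub>P\<^esub> \<omega> = \<omega>"
    "\<And>A B \<omega>. A \<in> carrier P \<Longrightarrow> B \<in> carrier P \<Longrightarrow> \<omega> \<in> \<Omega> \<Longrightarrow> \<beta> (A \<otimes>\<^bsub>P\<^esub> B) \<omega> = \<beta> B (\<beta> A \<omega>)"
    and v_lip: "\<And>\<omega>. \<omega> \<in> \<Omega> \<Longrightarrow> v1 \<omega> \<in> lipschitz1 X1 d1"
    "\<And>\<omega>. \<omega> \<in> \<Omega> \<Longrightarrow> v2 \<omega> \<in> lipschitz1 X2 d2"
    and v_X0: "\<And>\<omega> z. \<omega> \<in> \<Omega> \<Longrightarrow> z \<in> X0 \<Longrightarrow> v1 \<omega> z = v2 \<omega> z"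
    and v_act: "\<And>g \<omega> x. g \<in> carrier G1 \<Longrightarrow> \<omega> \<in> \<Omega> \<Longrightarrow> x \<in> X1 \<Longrightarrow> v1 (\<beta> (\<iota>1 g) \<omega>) x = v1 \<omega> (\<phi>1 g x)"
    "\<And>g \<omega> x. g \<in> carrier G2 \<Longrightarrow> \<omega> \<in> \<Omega> \<Longrightarrow> x \<in> X2 \<Longrightarrow> v2 (\<beta> (\<iota>2 g) \<omega>) x = v2 \<omega> (\<phi>2 g x)"
    and v_hit: "\<And>f. f \<in> lipschitz1 X1 d1 \<Longrightarrow> \<exists>\<omega>\<in>\<Omega>. v1 \<omega> = f"
    "\<And>f. f \<in> lipschitz1 X2 d2 \<Longrightarrow> \<exists>\<omega>\<in>\<Omega>. v2 \<omega> = f"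
    by (rule value_system) (rule that; assumption)
  have v1_dist: "\<bar>v1 \<omega> x - v1 \<omega> y\<bar> \<le> d1 x y" if "\<omega> \<in> \<Omega>" "x \<in> X1" "y \<in> X1" for \<omega> x y
  proof -
    have "v1 \<omega> x \<le> v1 \<omega> y + d1 x y" "v1 \<omega> y \<le> v1 \<omega> x + d1 y x"
      using v_lip(1)[OF that(1)] that by (auto simp: lipschitz1_def)
    then show ?thesis by (simp add: M1.commute[of y x])
  qed
  have v2_dist: "\<bar>v2 \<omega> x - v2 \<omega> y\<bar> \<le> d2 x y" if "\<omega> \<in> \<Omega>" "x \<in> X2" "y \<in> X2" for \<omega> x y
  proof -
    have "v2 \<omega> x \<le> v2 \<omega> y + d2 x y" "v2 \<omega> y \<le> v2 \<omega> x + d2 y x"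
      using v_lip(2)[OF that(1)] that by (auto simp: lipschitz1_def)
    then show ?thesis by (simp add: M2.commute[of y x])
  qed
  obtain x0 where x0: "x0 \<in> X0" "x0 \<in> X1" "x0 \<in> X2"
    using X0 by blast
  have hit1: "\<exists>\<omega>\<in>\<Omega>. \<forall>y\<in>X1. v1 \<omega> y = d1 x y" if "x \<in> X1" for x
    using v_hit(1)[OF dist_lipschitz1[OF M1.Metric_space_axioms that]] by (metis restrict_apply')
  have hit2: "\<exists>\<omega>\<in>\<Omega>. \<forall>y\<in>X2. v2 \<omega> y = d2 x y" if "x \<in> X2" for x
    using v_hit(2)[OF dist_lipschitz1[OF M2.Metric_space_axioms that]] by (metis restrict_apply')
  have ne: "\<Omega> \<noteq> {}"
    using hit1[OF x0(2)] by blast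

  define E where "E s \<omega> = (case s of (A, x) \<Rightarrow> case_sum (v1 (\<beta> A \<omega>)) (v2 (\<beta> A \<omega>)) x)" for s \<omega>
  have E_simps [simp]: "E (A, Inl x) \<omega> = v1 (\<beta> A \<omega>) x" "E (A, Inr y) \<omega> = v2 (\<beta> A \<omega>) y" for A x y \<omega>
    by (simp_all add: E_def)
  have E_mult: "E (A \<otimes>\<^bsub>P\<^esub> B, x) \<omega> = E (B, x) (\<beta> A \<omega>)"
    if "A \<in> carrier P" "B \<in> carrier P" "\<omega> \<in> \<Omega>" for A B x \<omega>
    using that by (simp add: E_def \<beta>)
  \<comment> \<open>Finiteness of the supremum.  Moving the base point by one letter \<open>g\<close> changes its value by
    at most the distance from \<open>x0\<close> to \<open>g \<cdot> x0\<close>, whatever the state.  Since \<open>x0\<close> lies in \<open>X0\<close>,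
    letters of both groups can be treated with the same point.\<close>
  have bounded_move: "\<exists>c. \<forall>\<omega>\<in>\<Omega>. \<bar>v1 (\<beta> A \<omega>) x0 - v1 \<omega> x0\<bar> \<le> c" if "A \<in> carrier P" for A
    using that
  proof (induction rule: amalg_prod_induct)
    case one
    show ?case by (rule exI[of _ 0]) (simp add: \<beta>)
  next
    case (incl1 g A)
    then obtain c where c: "\<And>\<omega>. \<omega> \<in> \<Omega> \<Longrightarrow> \<bar>v1 (\<beta> A \<omega>) x0 - v1 \<omega> x0\<bar> \<le> c" by blast
    have "\<bar>v1 (\<beta> (\<iota>1 g \<otimes>\<^bsub>P\<^esub> A) \<omega>) x0 - v1 \<omega> x0\<bar> \<le> c + d1 (\<phi>1 g x0) x0" if \<omega>: "\<omega> \<in> \<Omega>" for \<omega>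
    proof -
      have \<omega>': "\<beta> (\<iota>1 g) \<omega> \<in> \<Omega>"
        using incl1(1) \<omega> by (simp add: \<beta>)
      have "\<phi>1 g x0 \<in> X1"
        using isometric_actionD(2)[OF act1 incl1(1) x0(2)] .
      from v1_dist[OF \<omega> this x0(2)] show ?thesis
        using c[OF \<omega>'] v_act(1)[OF incl1(1) \<omega> x0(2)]
          \<beta>(3)[OF incl_closed(1)[OF incl1(1)] incl1(2) \<omega>] by simp
    qed
    then show ?case by blast
  next
    case (incl2 g A)
    then obtain c where c: "\<And>\<omega>. \<omega> \<in> \<Omega> \<Longrightarrow> \<bar>v1 (\<beta> A \<omega>) x0 - v1 \<omega> x0\<bar> \<le> c" by blast
    have "\<bar>v1 (\<beta> (\<iota>2 g \<otimes>\<^bsub>P\<^esub> A) \<omega>) x0 - v1 \<omega> x0\<bar> \<le> c + d2 (\<phi>2 g x0) x0" if \<omega>: "\<omega> \<in> \<Omega>" for \<omega>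
    proof -
      have \<omega>': "\<beta> (\<iota>2 g) \<omega> \<in> \<Omega>"
        using incl2(1) \<omega> by (simp add: \<beta>)
      have "\<phi>2 g x0 \<in> X2"
        using isometric_actionD(2)[OF act2 incl2(1) x0(3)] .
      from v2_dist[OF \<omega> this x0(3)] show ?thesis
        using c[OF \<omega>'] v_act(2)[OF incl2(1) \<omega> x0(3)]
          v_X0[OF \<omega> x0(1)] v_X0[OF \<omega>' x0(1)]
          \<beta>(3)[OF incl_closed(2)[OF incl2(1)] incl2(2) \<omega>] by simp
    qed
    then show ?case by blast
  qed
  have bounded_E: "\<exists>c. \<forall>\<omega>\<in>\<Omega>. \<bar>E s \<omega> - v1 \<omega> x0\<bar> \<le> c" if s: "s \<in> ?S" for s
  proof -
    obtain A x where s: "s = (A, x)" "A \<in> carrier P" "x \<in> X1 <+> X2"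
      using s by blast
    from bounded_move[OF s(2)] obtain c where c: "\<And>\<omega>. \<omega> \<in> \<Omega> \<Longrightarrow> \<bar>v1 (\<beta> A \<omega>) x0 - v1 \<omega> x0\<bar> \<le> c" by blast
    show ?thesis
      using s(3)
    proof (elim PlusE)
      fix y assume y: "y \<in> X1" "x = Inl y"
      have "\<bar>E s \<omega> - v1 \<omega> x0\<bar> \<le> c + d1 y x0" if "\<omega> \<in> \<Omega>" for \<omega>
        using c[OF that] v1_dist[OF \<beta>(1)[OF s(2) that] y(1) x0(2)] s(1) y(2) by simp
      then show ?thesis by blast
    next
      fix y assume y: "y \<in> X2" "x = Inr y"
      have "\<bar>E s \<omega> - v1 \<omega> x0\<bar> \<le> c + d2 y x0" if "\<omega> \<in> \<Omega>" for \<omega>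
        using c[OF that] v2_dist[OF \<beta>(1)[OF s(2) that] y(1) x0(3)] s(1) y(2)
          v_X0[OF \<beta>(1)[OF s(2) that] x0(1)] by simp
      then show ?thesis by blast
    qed
  qed

  define p where "p s t = (SUP \<omega>\<in>\<Omega>. \<bar>E s \<omega> - E t \<omega>\<bar>)" for s t
  have le_p: "\<bar>E s \<omega> - E t \<omega>\<bar> \<le> p s t" if st: "s \<in> ?S" "t \<in> ?S" and \<omega>: "\<omega> \<in> \<Omega>" for s t \<omega>
  proof -
    from bounded_E[OF st(1)] obtain a where a: "\<forall>\<omega>\<in>\<Omega>. \<bar>E s \<omega> - v1 \<omega> x0\<bar> \<le> a" ..
    from bounded_E[OF st(2)] obtain b where b: "\<forall>\<omega>\<in>\<Omega>. \<bar>E t \<omega> - v1 \<omega> x0\<bar> \<le> b" ..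
    have "\<bar>E s \<omega> - E t \<omega>\<bar> \<le> a + b" if "\<omega> \<in> \<Omega>" for \<omega>
      using bspec[OF a that] bspec[OF b that] by linarith
    then have "bdd_above ((\<lambda>\<omega>. \<bar>E s \<omega> - E t \<omega>\<bar>) ` \<Omega>)"
      by (rule bdd_aboveI2)
    then show ?thesis
      unfolding p_def by (rule cSUP_upper[OF \<omega>])
  qed
  have p_le: "p s t \<le> c" if "\<And>\<omega>. \<omega> \<in> \<Omega> \<Longrightarrow> \<bar>E s \<omega> - E t \<omega>\<bar> \<le> c" for s t c
    unfolding p_def by (rule cSUP_least[OF ne that])
  have p_nonneg: "0 \<le> p s t" if "s \<in> ?S" "t \<in> ?S" for s t
    using le_p[OF that] ne by fastforce
  have p_zero: "p s t = 0" if "s \<in> ?S" "t \<in> ?S" "\<And>\<omega>. \<omega> \<in> \<Omega> \<Longrightarrow> E s \<omega> = E t \<omega>" for s t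
    using p_le[of s t 0] p_nonneg[OF that(1,2)] that(3) by simp
  show ?thesis
  proof (rule that[of p])
    show "p s s = 0" for s using ne by (simp add: p_def)
    show "p s t = p t s" for s t by (simp add: p_def abs_minus_commute)
    fix s t u assume stu: "s \<in> ?S" "t \<in> ?S" "u \<in> ?S"
    show "p s u \<le> p s t + p t u"
    proof (rule p_le)
      fix \<omega> assume "\<omega> \<in> \<Omega>"
      then show "\<bar>E s \<omega> - E u \<omega>\<bar> \<le> p s t + p t u"
        using le_p[OF stu(1,2), of \<omega>] le_p[OF stu(2,3), of \<omega>] by linarith
    qed
  next
    fix A B C x y
    assume *: "A \<in> carrier P" "B \<in> carrier P" "C \<in> carrier P" "x \<in> X1 <+> X2" "y \<in> X1 <+> X2"
    show "p (A \<otimes>\<^bsub>P\<^esub> B, x) (A \<otimes>\<^bsub>P\<^esub> C, y) = p (B, x) (C, y)"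
    proof (rule antisym)
      show "p (A \<otimes>\<^bsub>P\<^esub> B, x) (A \<otimes>\<^bsub>P\<^esub> C, y) \<le> p (B, x) (C, y)"
        using * by (intro p_le) (simp add: E_mult \<beta> le_p)
      have "\<beta> A (\<beta> (inv\<^bsub>P\<^esub> A) \<omega>) = \<omega>" if "\<omega> \<in> \<Omega>" for \<omega>
        using \<beta>(3)[of "inv\<^bsub>P\<^esub> A" A \<omega>] \<beta>(2)[OF that] *(1) that by simp
      then have "E (B, x) \<omega> = E (A \<otimes>\<^bsub>P\<^esub> B, x) (\<beta> (inv\<^bsub>P\<^esub> A) \<omega>)"
        "E (C, y) \<omega> = E (A \<otimes>\<^bsub>P\<^esub> C, y) (\<beta> (inv\<^bsub>P\<^esub> A) \<omega>)" if "\<omega> \<in> \<Omega>" for \<omega>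
        using * that by (simp_all add: E_mult \<beta>)
      then show "p (B, x) (C, y) \<le> p (A \<otimes>\<^bsub>P\<^esub> B, x) (A \<otimes>\<^bsub>P\<^esub> C, y)"
        using * by (intro p_le) (simp add: \<beta> le_p)
    qed
  next
    fix x y assume *: "x \<in> X1" "y \<in> X1"
    obtain \<omega> where \<omega>: "\<omega> \<in> \<Omega>" "\<forall>y\<in>X1. v1 \<omega> y = d1 x y"
      using hit1[OF *(1)] by blast
    show "p (\<one>\<^bsub>P\<^esub>, Inl x) (\<one>\<^bsub>P\<^esub>, Inl y) = d1 x y"
      using le_p[of "(\<one>\<^bsub>P\<^esub>, Inl x)" "(\<one>\<^bsub>P\<^esub>, Inl y)" \<omega>] \<omega> * v1_dist
      by (intro antisym p_le) (auto simp: \<beta>)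
  next
    fix x y assume *: "x \<in> X2" "y \<in> X2"
    obtain \<omega> where \<omega>: "\<omega> \<in> \<Omega>" "\<forall>y\<in>X2. v2 \<omega> y = d2 x y"
      using hit2[OF *(1)] by blast
    show "p (\<one>\<^bsub>P\<^esub>, Inr x) (\<one>\<^bsub>P\<^esub>, Inr y) = d2 x y"
      using le_p[of "(\<one>\<^bsub>P\<^esub>, Inr x)" "(\<one>\<^bsub>P\<^esub>, Inr y)" \<omega>] \<omega> * v2_dist
      by (intro antisym p_le) (auto simp: \<beta>)
  next
    fix z assume "z \<in> X0"
    then show "p (\<one>\<^bsub>P\<^esub>, Inl z) (\<one>\<^bsub>P\<^esub>, Inr z) = 0"
      using X0 by (intro p_zero) (auto simp: \<beta> v_X0)
  next
    fix g x assume "g \<in> carrier G1" "x \<in> X1"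
    then show "p (\<iota>1 g, Inl x) (\<one>\<^bsub>P\<^esub>, Inl (\<phi>1 g x)) = 0"
      using isometric_actionD(2)[OF act1] by (intro p_zero) (auto simp: \<beta> v_act)
  next
    fix g x assume "g \<in> carrier G2" "x \<in> X2"
    then show "p (\<iota>2 g, Inr x) (\<one>\<^bsub>P\<^esub>, Inr (\<phi>2 g x)) = 0"
      using isometric_actionD(2)[OF act2] by (intro p_zero) (auto simp: \<beta> v_act)
  qed (rule p_nonneg)
qed

end

section \<open>Metric quotients of isometric actions\<close>

text \<open>
  The metric quotient of a pseudometric space with an isometric action.  The map \<open>\<kappa>\<close> may be
  any realisation of the quotient, which leaves the choice of the type of points open.
\<close>

lemma quotient_isometric_action:
  fixes G (structure) and \<delta> :: "'s \<Rightarrow> 's \<Rightarrow> real" and \<kappa> :: "'s \<Rightarrow> 'y"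
  assumes G: "group G"
    and nonneg: "\<And>s t. s \<in> S \<Longrightarrow> t \<in> S \<Longrightarrow> 0 \<le> \<delta> s t"
    and sym: "\<And>s t. s \<in> S \<Longrightarrow> t \<in> S \<Longrightarrow> \<delta> s t = \<delta> t s"
    and triangle: "\<And>s t u. s \<in> S \<Longrightarrow> t \<in> S \<Longrightarrow> u \<in> S \<Longrightarrow> \<delta> s u \<le> \<delta> s t + \<delta> t u"
    and \<kappa>: "\<And>s t. s \<in> S \<Longrightarrow> t \<in> S \<Longrightarrow> \<kappa> s = \<kappa> t \<longleftrightarrow> \<delta> s t = 0"
    and a_closed: "\<And>g s. g \<in> carrier G \<Longrightarrow> s \<in> S \<Longrightarrow> a g s \<in> S"
    and a_one: "\<And>s. s \<in> S \<Longrightarrow> a \<one> s = s"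
    and a_mult: "\<And>g h s. g \<in> carrier G \<Longrightarrow> h \<in> carrier G \<Longrightarrow> s \<in> S \<Longrightarrow> a (g \<otimes> h) s = a g (a h s)"
    and a_isom: "\<And>g s t. g \<in> carrier G \<Longrightarrow> s \<in> S \<Longrightarrow> t \<in> S \<Longrightarrow> \<delta> (a g s) (a g t) = \<delta> s t"
  obtains d \<phi> where "isometric_action G (\<kappa> ` S) d \<phi>"
    "\<And>s t. s \<in> S \<Longrightarrow> t \<in> S \<Longrightarrow> d (\<kappa> s) (\<kappa> t) = \<delta> s t"
    "\<And>g s. g \<in> carrier G \<Longrightarrow> s \<in> S \<Longrightarrow> \<phi> g (\<kappa> s) = \<kappa> (a g s)"
proof -
  interpret group G by fact
  let ?Y = "\<kappa> ` S"
  define pick where "pick = inv_into S \<kappa>"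
  have pick: "pick (\<kappa> s) \<in> S" "\<kappa> (pick (\<kappa> s)) = \<kappa> s" if "s \<in> S" for s
    using that by (simp_all add: pick_def inv_into_into f_inv_into_f)
  have cong: "\<delta> s t = \<delta> s' t'"
    if "s \<in> S" "t \<in> S" "s' \<in> S" "t' \<in> S" "\<kappa> s = \<kappa> s'" "\<kappa> t = \<kappa> t'" for s t s' t'
  proof -
    have "\<delta> s s' = 0" "\<delta> s' s = 0" "\<delta> t t' = 0" "\<delta> t' t = 0"
      using that \<kappa>[of s s'] \<kappa>[of s' s] \<kappa>[of t t'] \<kappa>[of t' t] by auto
    then show ?thesis
      using triangle[of s s' t] triangle[of s' t' t] triangle[of s' s t'] triangle[of s t t'] that
      by linarith
  qed
  define d where "d x y = (if x \<in> ?Y \<and> y \<in> ?Y then \<delta> (pick x) (pick y) else 0)" for x y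
  have d: "d (\<kappa> s) (\<kappa> t) = \<delta> s t" if "s \<in> S" "t \<in> S" for s t
    using that pick by (simp add: d_def) (rule cong; simp)
  define \<phi> where "\<phi> g = (\<lambda>x\<in>?Y. \<kappa> (a g (pick x)))" for g
  have \<phi>: "\<phi> g (\<kappa> s) = \<kappa> (a g s)" if "g \<in> carrier G" "s \<in> S" for g s
  proof -
    have "\<delta> (pick (\<kappa> s)) s = 0"
      using \<kappa>[of "pick (\<kappa> s)" s] pick[OF that(2)] that by simp
    then show ?thesis
      using that pick[OF that(2)] \<kappa> by (simp add: \<phi>_def a_closed a_isom)
  qed
  have Bij: "\<phi> g \<in> Bij ?Y" if g: "g \<in> carrier G" for g
  proof -
    have "\<phi> (inv g) (\<phi> g x) = x" "\<phi> g (\<phi> (inv g) x) = x" "\<phi> g x \<in> ?Y" "\<phi> (inv g) x \<in> ?Y"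
      if "x \<in> ?Y" for x
      using that g by (auto simp: \<phi> a_closed a_mult[symmetric] a_one)
    then have "bij_betw (\<phi> g) ?Y ?Y"
      by (intro bij_betw_byWitness[where f' = "\<phi> (inv g)"]) auto
    then show ?thesis
      by (simp add: Bij_def \<phi>_def)
  qed
  have "\<phi> \<in> hom G (BijGroup ?Y)"
  proof (rule homI)
    fix g h assume gh: "g \<in> carrier G" "h \<in> carrier G"
    have "\<phi> (g \<otimes> h) = compose ?Y (\<phi> g) (\<phi> h)"
    proof
      fix x show "\<phi> (g \<otimes> h) x = compose ?Y (\<phi> g) (\<phi> h) x"
        using gh by (cases "x \<in> ?Y") (auto simp: compose_def \<phi> a_closed a_mult, simp add: \<phi>_def)
    qed
    then show "\<phi> (g \<otimes> h) = \<phi> g \<otimes>\<^bsub>BijGroup ?Y\<^esub> \<phi> h"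
      using gh Bij by (simp add: BijGroup_def)
  qed (simp add: BijGroup_def Bij)
  then have "group_action G ?Y \<phi>"
    by (intro group_action.intro group_hom.intro group_hom_axioms.intro group_BijGroup G)
  moreover have "Metric_space ?Y d"
  proof
    show "0 \<le> d x y" for x y
      using nonneg pick by (auto simp: d_def)
    show "d x y = d y x" for x y
      using sym pick by (auto simp: d_def)
    show "d x y = 0 \<longleftrightarrow> x = y" if "x \<in> ?Y" "y \<in> ?Y" for x y
      using that \<kappa> by (auto simp: d)
    show "d x z \<le> d x y + d y z" if "x \<in> ?Y" "y \<in> ?Y" "z \<in> ?Y" for x y z
      using that triangle by (auto simp: d)
  qed
  ultimately have "isometric_action G ?Y d \<phi>"
    by (auto simp: isometric_action_def d \<phi> a_closed a_isom)
  then show ?thesis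
    using d \<phi> by (rule that)
qed

section \<open>Comparing density characters\<close>

lemma metric_dense_iff:
  assumes "Metric_space X d"
  shows "metric_dense X d D \<longleftrightarrow> D \<subseteq> X \<and> (\<forall>x\<in>X. \<forall>r>0. \<exists>y\<in>D. d x y < r)"
proof -
  interpret Metric_space X d by fact
  show ?thesis
    unfolding metric_dense_def metric_closure_of in_mball by blast
qed

lemma finite_metric_dense:
  assumes "Metric_space X d" "metric_dense X d D" "finite D"
  shows "finite X"
proof -
  interpret Metric_space X d by fact
  have D: "D \<subseteq> X" "\<forall>x\<in>X. \<forall>r>0. \<exists>y\<in>D. d x y < r"
    using assms(2) unfolding metric_dense_iff[OF assms(1)] by blast+
  have "x \<in> D" if x: "x \<in> X" for x
  proof (rule ccontr)
    assume xD: "x \<notin> D"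
    have "D \<noteq> {}" using D(2)[rule_format, OF x, of 1] by auto
    moreover have "0 < d x y" if "y \<in> D" for y
      using that x xD D(1) by (intro mdist_pos_less) auto
    ultimately have "0 < Min (d x ` D)"
      using assms(3) by simp
    from D(2)[rule_format, OF x this] obtain y where y: "y \<in> D" "d x y < Min (d x ` D)"
      by blast
    have "Min (d x ` D) \<le> d x y"
      using y(1) assms(3) by (intro Min_le) simp_all
    with y(2) show False by simp
  qed
  then have "X \<subseteq> D" ..
  then show ?thesis
    using assms(3) by (rule finite_subset)
qed

text \<open>
  A dense set of the large space need not meet the image of the small one.  But for each of its
  points \<open>y\<close> and each \<open>n\<close> one can select a point of \<open>X\<close> whose image is \<open>1 / (n + 1)\<close>-close to \<open>y\<close>, if
  there is any; the selected points are dense, and \<open>|E \<times> \<nat>| = |E|\<close> as \<open>E\<close> is infinite.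
\<close>

lemma dens_isometric_embedding:
  assumes X: "Metric_space X d" and Y: "Metric_space Y e"
    and \<rho>: "isometric_embedding X d Y e \<rho>" and E: "metric_dense Y e E" "infinite E"
  shows "dens X d \<le>o |E|"
proof -
  interpret X: Metric_space X d by fact
  interpret Y: Metric_space Y e by fact
  have \<rho>_in: "\<rho> x \<in> Y" if "x \<in> X" for x
    using \<rho> that by (auto simp: isometric_embedding_def)
  have \<rho>_dist: "e (\<rho> x) (\<rho> y) = d x y" if "x \<in> X" "y \<in> X" for x y
    using \<rho> that by (auto simp: isometric_embedding_def)
  define near where "near = (\<lambda>(y, n::nat) x. x \<in> X \<and> e (\<rho> x) y < 1 / Suc n)"
  define c where "c q = (SOME x. near q x)" for q
  let ?Q = "{q \<in> E \<times> UNIV. \<exists>x. near q x}"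
  have c: "near q (c q)" if "\<exists>x. near q x" for q
    unfolding c_def using that by (rule someI_ex)
  have "metric_dense X d (c ` ?Q)"
    unfolding metric_dense_iff[OF X]
  proof (intro conjI ballI allI impI)
    show "c ` ?Q \<subseteq> X"
      using c by (auto simp: near_def)
    fix x and r :: real assume x: "x \<in> X" and r: "0 < r"
    then obtain n :: nat where n: "2 / Suc n < r"
      using reals_Archimedean[of "r / 2"] by (auto simp: field_simps)
    have "\<forall>x\<in>Y. \<forall>r>0. \<exists>y\<in>E. e x y < r"
      using E(1) by (simp add: metric_dense_iff[OF Y])
    then obtain y where y: "y \<in> E" "e (\<rho> x) y < 1 / Suc n"
      using \<rho>_in[OF x] by (meson of_nat_0_less_iff zero_less_Suc zero_less_divide_1_iff)
    then have "near (y, n) x" using x by (simp add: near_def)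
    then have q: "(y, n) \<in> ?Q" using y by blast
    then have cq: "c (y, n) \<in> X" "e (\<rho> (c (y, n))) y < 1 / Suc n"
      using c[of "(y, n)"] by (auto simp: near_def)
    have yY: "y \<in> Y" using E(1) y by (auto simp: metric_dense_def)
    have "d x (c (y, n)) \<le> e (\<rho> x) y + e (\<rho> (c (y, n))) y"
      using Y.triangle'[OF \<rho>_in[OF x] yY \<rho>_in[OF cq(1)]] \<rho>_dist[OF x cq(1)] by simp
    also have "\<dots> < 2 / Suc n" using y cq by simp
    finally show "\<exists>y\<in>c ` ?Q. d x y < r" using n q by force
  qed
  then have "dens X d \<le>o |c ` ?Q|"
    by (rule dens_least(2)[OF X])
  also have "|c ` ?Q| \<le>o |?Q|"
    by (rule card_of_image)
  also have "|?Q| \<le>o |E \<times> (UNIV :: nat set)|"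
    by (rule card_of_mono1) blast
  also have "|E \<times> (UNIV :: nat set)| \<le>o |E|"
    using card_of_Times_infinite[OF E(2), of "UNIV :: nat set"] infinite_iff_card_of_nat E(2)
      ordIso_imp_ordLeq by blast
  finally show ?thesis .
qed

lemma card_max_cases:
  assumes "Card_order r" "Card_order s"
  obtains "s \<le>o r" "card_max r s =o r" | "r \<le>o s" "card_max r s =o s"
  using card_max_ordIso[OF assms] ordLeq_total[of r s] assms
  by (meson card_order_on_well_order_on)

lemma card_max_bounds:
  assumes "Card_order r" "Card_order s"
  shows "Card_order (card_max r s)" "r \<le>o card_max r s" "s \<le>o card_max r s"
    and "r \<le>o t \<Longrightarrow> s \<le>o t \<Longrightarrow> card_max r s \<le>o t"
    and "cinfinite (card_max r s) \<longleftrightarrow> cinfinite r \<or> cinfinite s"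
proof -
  have "Card_order (card_max r s) \<and> r \<le>o card_max r s \<and> s \<le>o card_max r s \<and>
      (r \<le>o t \<longrightarrow> s \<le>o t \<longrightarrow> card_max r s \<le>o t) \<and>
      (cinfinite (card_max r s) \<longleftrightarrow> cinfinite r \<or> cinfinite s)"
    using assms
  proof (cases rule: card_max_cases)
    case 1
    then show ?thesis
      using assms by (meson Card_order_ordIso cinfinite_mono ordIso_iff_ordLeq ordLeq_transitive)
  next
    case 2
    then show ?thesis
      using assms by (meson Card_order_ordIso cinfinite_mono ordIso_iff_ordLeq ordLeq_transitive)
  qed
  then show "Card_order (card_max r s)" "r \<le>o card_max r s" "s \<le>o card_max r s"
    "r \<le>o t \<Longrightarrow> s \<le>o t \<Longrightarrow> card_max r s \<le>o t"
    "cinfinite (card_max r s) \<longleftrightarrow> cinfinite r \<or> cinfinite s"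
    by blast+
qed

lemma finite_isometric_embedding:
  assumes "Metric_space X d" "Metric_space Y e" "isometric_embedding X d Y e \<rho>" "finite Y"
  shows "finite X"
proof -
  interpret X: Metric_space X d by fact
  interpret Y: Metric_space Y e by fact
  have \<rho>: "\<rho> ` X \<subseteq> Y" "\<And>x y. x \<in> X \<Longrightarrow> y \<in> X \<Longrightarrow> e (\<rho> x) (\<rho> y) = d x y"
    using assms(3) by (auto simp: isometric_embedding_def)
  have "x = y" if "x \<in> X" "y \<in> X" "\<rho> x = \<rho> y" for x y
  proof -
    have "\<rho> y \<in> Y" using \<rho>(1) that(2) by blast
    then have "d x y = 0" using \<rho>(2)[OF that(1,2)] that(3) by simp
    then show ?thesis using that by simp
  qed
  then have "inj_on \<rho> X" by (rule inj_onI)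
  then show ?thesis using \<rho>(1) assms(4) by (rule inj_on_finite)
qed

section \<open>The amalgam\<close>

lemma Inl_in_Plus_iff: "Inl x \<in> A <+> B \<longleftrightarrow> x \<in> A"
  and Inr_in_Plus_iff: "Inr y \<in> A <+> B \<longleftrightarrow> y \<in> B"
  by auto

context amalgamation_problem begin

text \<open>
  An amalgam with a free orbit of isolated points, the hairs \<open>\<theta> A\<close>.  The hair \<open>\<theta> A\<close> has length 1
  and is attached at the translate by \<open>A\<close> of a fixed point \<open>x0\<close> of \<open>X1\<close>; only its tip belongs to
  the space.  The map \<open>\<eta>\<close> sends \<open>(A, x)\<close> to the point \<open>A \<cdot> x\<close>.
\<close>

lemma amalgam_with_discrete_orbit:
  obtains X3 :: "((('g + 'g) list set \<times> ('x + 'x)) set \<times> ('g + 'g) list set) set" and d3 \<phi>3 \<eta> \<theta>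
  where "amalgam_of_actions G1 G0 G2 X0 X1 d1 \<phi>1 X2 d2 \<phi>2 X3 d3 \<phi>3"
    and "X3 = \<eta> ` (carrier P \<times> (X1 <+> X2)) \<union> \<theta> ` carrier P"
    and "\<And>A x y. A \<in> carrier P \<Longrightarrow> x \<in> X1 \<Longrightarrow> y \<in> X1 \<Longrightarrow> d3 (\<eta> (A, Inl x)) (\<eta> (A, Inl y)) = d1 x y"
    and "\<And>A x y. A \<in> carrier P \<Longrightarrow> x \<in> X2 \<Longrightarrow> y \<in> X2 \<Longrightarrow> d3 (\<eta> (A, Inr x)) (\<eta> (A, Inr y)) = d2 x y"
    and "inj_on \<theta> (carrier P)"
    and "\<And>A u. A \<in> carrier P \<Longrightarrow> u \<in> X3 \<Longrightarrow> u \<noteq> \<theta> A \<Longrightarrow> 1 \<le> d3 (\<theta> A) u"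
proof -
  let ?S = "carrier P \<times> (X1 <+> X2)"
  interpret M1: Metric_space X1 d1 by (rule isometric_actionD(1)[OF act1])
  interpret M2: Metric_space X2 d2 by (rule isometric_actionD(1)[OF act2])
  obtain p :: "('g + 'g) list set \<times> ('x + 'x) \<Rightarrow> ('g + 'g) list set \<times> ('x + 'x) \<Rightarrow> real" where
    p_nonneg: "\<And>s t. s \<in> ?S \<Longrightarrow> t \<in> ?S \<Longrightarrow> 0 \<le> p s t"
    and p_self: "\<And>s. p s s = 0"
    and p_sym: "\<And>s t. p s t = p t s"
    and p_triangle: "\<And>s t u. s \<in> ?S \<Longrightarrow> t \<in> ?S \<Longrightarrow> u \<in> ?S \<Longrightarrow> p s u \<le> p s t + p t u"
    and p_mult: "\<And>A B C x y. A \<in> carrier P \<Longrightarrow> B \<in> carrier P \<Longrightarrow> C \<in> carrier P \<Longrightarrow> x \<in> X1 <+> X2 \<Longrightarrow> y \<in> X1 <+> X2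
      \<Longrightarrow> p (A \<otimes>\<^bsub>P\<^esub> B, x) (A \<otimes>\<^bsub>P\<^esub> C, y) = p (B, x) (C, y)"
    and p_d1: "\<And>x y. x \<in> X1 \<Longrightarrow> y \<in> X1 \<Longrightarrow> p (\<one>\<^bsub>P\<^esub>, Inl x) (\<one>\<^bsub>P\<^esub>, Inl y) = d1 x y"
    and p_d2: "\<And>x y. x \<in> X2 \<Longrightarrow> y \<in> X2 \<Longrightarrow> p (\<one>\<^bsub>P\<^esub>, Inr x) (\<one>\<^bsub>P\<^esub>, Inr y) = d2 x y"
    and p_X0: "\<And>z. z \<in> X0 \<Longrightarrow> p (\<one>\<^bsub>P\<^esub>, Inl z) (\<one>\<^bsub>P\<^esub>, Inr z) = 0"
    and p_act1: "\<And>g x. g \<in> carrier G1 \<Longrightarrow> x \<in> X1 \<Longrightarrow> p (\<iota>1 g, Inl x) (\<one>\<^bsub>P\<^esub>, Inl (\<phi>1 g x)) = 0"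
    and p_act2: "\<And>g x. g \<in> carrier G2 \<Longrightarrow> x \<in> X2 \<Longrightarrow> p (\<iota>2 g, Inr x) (\<one>\<^bsub>P\<^esub>, Inr (\<phi>2 g x)) = 0"
    by (rule amalgam_pseudometric) (rule that; assumption)
  obtain x0 where x0: "x0 \<in> X1"
    using X0 by blast

  let ?T = "?S <+> carrier P"
  \<comment> \<open>The foot \<open>f a\<close> and the height \<open>w a\<close> of a point of the space with hairs.\<close>
  define f :: "_ \<Rightarrow> ('g + 'g) list set \<times> ('x + 'x)" where "f = case_sum id (\<lambda>A. (A, Inl x0))"
  define w :: "(('g + 'g) list set \<times> ('x + 'x)) + ('g + 'g) list set \<Rightarrow> real" where "w = case_sum (\<lambda>_. 0) (\<lambda>_. 1)"
  define \<delta> where "\<delta> a b = (if a = b then 0 else p (f a) (f b) + w a + w b)" for a b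
  define mv where "mv A = map_sum (map_prod ((\<otimes>\<^bsub>P\<^esub>) A) (id :: 'x + 'x \<Rightarrow> _)) ((\<otimes>\<^bsub>P\<^esub>) A)" for A
  \<comment> \<open>The points of \<open>?S\<close> become their classes; the tips of the hairs are told apart from these by
    an empty first component.\<close>
  define k where "k = case_sum (\<lambda>s. ({t \<in> ?S. p s t = 0}, {})) (\<lambda>A :: ('g + 'g) list set. ({}, A))"
  have f: "f a \<in> ?S" if "a \<in> ?T" for a
    using that x0 by (auto simp: f_def)
  have w: "0 \<le> w a" for a by (simp add: w_def split: sum.split)
  have \<delta>_Inl: "\<delta> (Inl s) (Inl t) = p s t" for s t
    by (simp add: \<delta>_def f_def w_def p_self)
  have \<delta>_Inr: "1 \<le> \<delta> (Inr A) b" "1 \<le> \<delta> b (Inr A)" if "A \<in> carrier P" "b \<in> ?T" "b \<noteq> Inr A" for A b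
  proof -
    have "Inr A \<in> ?T" using that(1) by (rule InrI)
    then show "1 \<le> \<delta> (Inr A) b" "1 \<le> \<delta> b (Inr A)"
      using p_nonneg[OF f f, of "Inr A" b] p_nonneg[OF f f, of b "Inr A"] w[of b] that
      by (simp_all add: \<delta>_def w_def not_sym)
  qed
  have mv_simps: "mv A (Inl (B, x)) = Inl (A \<otimes>\<^bsub>P\<^esub> B, x)" "mv A (Inr B) = Inr (A \<otimes>\<^bsub>P\<^esub> B)" for A B x
    by (simp_all add: mv_def)
  have f_mv: "p (f (mv A a)) (f (mv A b)) = p (f a) (f b)" if "A \<in> carrier P" "a \<in> ?T" "b \<in> ?T" for A a b
  proof -
    have "f (mv A a) = (A \<otimes>\<^bsub>P\<^esub> fst (f a), snd (f a))" for a
      by (cases a) (simp_all add: f_def mv_def map_prod_def split_beta)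
    moreover have "fst (f a) \<in> carrier P" "snd (f a) \<in> X1 <+> X2" "fst (f b) \<in> carrier P" "snd (f b) \<in> X1 <+> X2"
      using f[OF that(2)] f[OF that(3)] by auto
    ultimately show ?thesis
      using that(1) by (simp add: p_mult)
  qed
  have w_mv: "w (mv A a) = w a" for A a
    by (cases a) (auto simp: w_def mv_def)
  have mv_inj: "mv A a = mv A b \<longleftrightarrow> a = b" if "A \<in> carrier P" "a \<in> ?T" "b \<in> ?T" for A a b
    using that by (auto simp: mv_simps P.Units_eq)
  obtain d3 \<phi>3 where iso: "isometric_action P (k ` ?T) d3 \<phi>3"
    and d3: "\<And>a b. a \<in> ?T \<Longrightarrow> b \<in> ?T \<Longrightarrow> d3 (k a) (k b) = \<delta> a b"
    and \<phi>3: "\<And>A a. A \<in> carrier P \<Longrightarrow> a \<in> ?T \<Longrightarrow> \<phi>3 A (k a) = k (mv A a)"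
  proof (rule quotient_isometric_action[OF P.is_group, of ?T \<delta> k mv])
    show "0 \<le> \<delta> a b" if "a \<in> ?T" "b \<in> ?T" for a b
      using p_nonneg[OF f[OF that(1)] f[OF that(2)]] w[of a] w[of b] by (simp add: \<delta>_def)
    show "\<delta> a b = \<delta> b a" for a b
      by (simp add: \<delta>_def p_sym)
    show "\<delta> a c \<le> \<delta> a b + \<delta> b c" if "a \<in> ?T" "b \<in> ?T" "c \<in> ?T" for a b c
      using p_triangle[OF f[OF that(1)] f[OF that(2)] f[OF that(3)]] w[of a] w[of b] w[of c]
        p_nonneg[OF f[OF that(1)] f[OF that(2)]] p_nonneg[OF f[OF that(2)] f[OF that(3)]]
      by (auto simp: \<delta>_def)
    show "k a = k b \<longleftrightarrow> \<delta> a b = 0" if a: "a \<in> ?T" and b: "b \<in> ?T" for a b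
    proof -
      have mixed: "k (Inl s) \<noteq> k (Inr A)" if "s \<in> ?S" for s and A :: "('g + 'g) list set"
      proof -
        have "s \<in> fst (k (Inl s))" "s \<notin> fst (k (Inr A))"
          using that by (simp_all add: k_def p_self)
        then show ?thesis by metis
      qed
      have cls: "k (Inl s) = k (Inl t) \<longleftrightarrow> p s t = 0" if st: "s \<in> ?S" "t \<in> ?S" for s t
      proof
        assume "k (Inl s) = k (Inl t)"
        moreover have "t \<in> fst (k (Inl t))"
          using st by (simp add: k_def p_self)
        ultimately have "t \<in> fst (k (Inl s))" by simp
        then show "p s t = 0" by (simp add: k_def)
      next
        assume "p s t = 0"
        then have "p s u = p t u" if "u \<in> ?S" for u
          using p_triangle[OF st that] p_triangle[OF st(2,1) that] p_sym[of t s] by linarith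
        then have "{u \<in> ?S. p s u = 0} = {u \<in> ?S. p t u = 0}"
          by (intro Collect_cong) (metis (no_types, lifting))
        then show "k (Inl s) = k (Inl t)"
          by (simp add: k_def)
      qed
      show ?thesis
        using a
      proof (elim PlusE)
        fix s assume s: "s \<in> ?S" "a = Inl s"
        show ?thesis
          using b
        proof (elim PlusE)
          fix t assume "t \<in> ?S" "b = Inl t"
          then show ?thesis using s cls[of s t] by (simp only: \<delta>_Inl)
        next
          fix B assume "B \<in> carrier P" "b = Inr B"
          then show ?thesis using s a mixed[OF s(1), of B] \<delta>_Inr(2)[of B a] by auto
        qed
      next
        fix A assume A: "A \<in> carrier P" "a = Inr A"
        show ?thesis
          using b
        proof (elim PlusE)
          fix t assume "t \<in> ?S" "b = Inl t"
          then show ?thesis using A b mixed[of t A] \<delta>_Inr(1)[of A b] by auto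
        next
          fix B assume B: "B \<in> carrier P" "b = Inr B"
          have "k a = k b \<longleftrightarrow> A = B"
            using A B by (auto simp: k_def)
          moreover have "\<delta> a b = 0 \<longleftrightarrow> A = B"
            using \<delta>_Inr(1)[OF A(1) b] A B by (cases "A = B") (simp_all add: \<delta>_def)
          ultimately show ?thesis by simp
        qed
      qed
    qed
    show "mv A a \<in> ?T" if "A \<in> carrier P" "a \<in> ?T" for A a
      using that by (auto simp: mv_simps)
    show "mv \<one>\<^bsub>P\<^esub> a = a" if "a \<in> ?T" for a
      using that by (auto simp: mv_simps)
    show "mv (A \<otimes>\<^bsub>P\<^esub> B) a = mv A (mv B a)" if "A \<in> carrier P" "B \<in> carrier P" "a \<in> ?T" for A B a
      using that by (auto simp: mv_simps P.m_assoc)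
    show "\<delta> (mv A a) (mv A b) = \<delta> a b" if "A \<in> carrier P" "a \<in> ?T" "b \<in> ?T" for A a b
      using that by (simp add: \<delta>_def mv_inj f_mv w_mv)
  qed (rule that; assumption)
  let ?X3 = "k ` ?T"
  note M3 = isometric_actionD(1)[OF iso]
  interpret M3: Metric_space ?X3 d3 by (rule M3)
  have k_eq: "k a = k b" if "a \<in> ?T" "b \<in> ?T" "\<delta> a b = 0" for a b
    using M3.zero[of "k a" "k b"] d3 that by simp

  define \<rho>1 where "\<rho>1 x = k (Inl (\<one>\<^bsub>P\<^esub>, Inl x))" for x
  define \<rho>2 where "\<rho>2 x = k (Inl (\<one>\<^bsub>P\<^esub>, Inr x))" for x
  have emb1: "isometric_embedding X1 d1 ?X3 d3 \<rho>1" and emb2: "isometric_embedding X2 d2 ?X3 d3 \<rho>2"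
    by (auto simp: isometric_embedding_def \<rho>1_def \<rho>2_def Inl_in_Plus_iff Inr_in_Plus_iff d3 \<delta>_Inl p_d1 p_d2)
  have amalgam: "amalgam_of_actions G1 G0 G2 X0 X1 d1 \<phi>1 X2 d2 \<phi>2 ?X3 d3 \<phi>3"
    unfolding amalgam_of_actions_def
  proof (intro conjI exI ballI)
    fix g x assume gx: "g \<in> carrier G1" "x \<in> X1"
    then show "\<rho>1 (\<phi>1 g x) = \<phi>3 (\<iota>1 g) (\<rho>1 x)"
      using isometric_actionD(2)[OF act1 gx] p_act1[OF gx]
      by (simp add: \<rho>1_def \<phi>3 mv_simps Inl_in_Plus_iff Inr_in_Plus_iff)
        (rule k_eq[symmetric]; simp add: \<delta>_Inl Inl_in_Plus_iff Inr_in_Plus_iff gx)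
  next
    fix g x assume gx: "g \<in> carrier G2" "x \<in> X2"
    then show "\<rho>2 (\<phi>2 g x) = \<phi>3 (\<iota>2 g) (\<rho>2 x)"
      using isometric_actionD(2)[OF act2 gx] p_act2[OF gx]
      by (simp add: \<rho>2_def \<phi>3 mv_simps Inl_in_Plus_iff Inr_in_Plus_iff)
        (rule k_eq[symmetric]; simp add: \<delta>_Inl Inl_in_Plus_iff Inr_in_Plus_iff gx)
  next
    fix x assume "x \<in> X0"
    then show "\<rho>1 x = \<rho>2 x"
      using X0 p_X0 unfolding \<rho>1_def \<rho>2_def
      by (intro k_eq) (auto simp: \<delta>_Inl)
  qed (rule iso emb1 emb2)+

  have p_same: "p (A, x) (A, y) = p (\<one>\<^bsub>P\<^esub>, x) (\<one>\<^bsub>P\<^esub>, y)"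
    if "A \<in> carrier P" "x \<in> X1 <+> X2" "y \<in> X1 <+> X2" for A x y
    using p_mult[of A "\<one>\<^bsub>P\<^esub>" "\<one>\<^bsub>P\<^esub>" x y] that by simp
  show ?thesis
  proof (rule that[OF amalgam, of "\<lambda>s. k (Inl s)" "\<lambda>A. k (Inr A)"])
    show "?X3 = (\<lambda>s. k (Inl s)) ` ?S \<union> (\<lambda>A. k (Inr A)) ` carrier P"
      by (simp add: Plus_def image_Un image_image)
    show "d3 (k (Inl (A, Inl x))) (k (Inl (A, Inl y))) = d1 x y"
      if "A \<in> carrier P" "x \<in> X1" "y \<in> X1" for A x y
      using that p_same[of A "Inl x" "Inl y"] by (simp add: d3 \<delta>_Inl p_d1 Inl_in_Plus_iff Inr_in_Plus_iff)
    show "d3 (k (Inl (A, Inr x))) (k (Inl (A, Inr y))) = d2 x y"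
      if "A \<in> carrier P" "x \<in> X2" "y \<in> X2" for A x y
      using that p_same[of A "Inr x" "Inr y"] by (simp add: d3 \<delta>_Inl p_d2 Inl_in_Plus_iff Inr_in_Plus_iff)
    show "inj_on (\<lambda>A. k (Inr A)) (carrier P)"
      by (auto simp: inj_on_def k_def)
    show "1 \<le> d3 (k (Inr A)) u" if A: "A \<in> carrier P" and u: "u \<in> ?X3" "u \<noteq> k (Inr A)" for A u
    proof -
      obtain b where b: "b \<in> ?T" "u = k b" using u(1) by blast
      then show ?thesis
        using \<delta>_Inr(1)[OF A b(1)] d3[OF InrI[OF A] b(1)] u(2) by metis
    qed
  qed
qed

abbreviation "\<kappa> \<equiv> card_max |carrier P| (card_max (dens X1 d1) (dens X2 d2))"

text \<open>
  A dense set contains all tips of hairs, hence is at least as large as \<open>P\<close>.  If \<open>\<kappa>\<close> is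
  infinite, then so is every dense set: a space with a finite dense set is finite, and then \<open>P\<close>, \<open>X1\<close>
  and \<open>X2\<close> would all be finite.
\<close>

lemma amalgam_exists:
  "\<exists>(X3 :: ((('g + 'g) list set \<times> ('x + 'x)) set \<times> ('g + 'g) list set) set) d3 \<phi>3.
    amalgam_of_actions G1 G0 G2 X0 X1 d1 \<phi>1 X2 d2 \<phi>2 X3 d3 \<phi>3 \<and>
    (if cinfinite \<kappa> then dens X3 d3 =o \<kappa> else \<not> cinfinite (dens X3 d3))"
proof -
  interpret M1: Metric_space X1 d1 by (rule isometric_actionD(1)[OF act1])
  interpret M2: Metric_space X2 d2 by (rule isometric_actionD(1)[OF act2])
  obtain X3 :: "((('g + 'g) list set \<times> ('x + 'x)) set \<times> ('g + 'g) list set) set" and d3 \<phi>3 \<eta> \<theta> where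
    amalgam: "amalgam_of_actions G1 G0 G2 X0 X1 d1 \<phi>1 X2 d2 \<phi>2 X3 d3 \<phi>3"
    and X3: "X3 = \<eta> ` (carrier P \<times> (X1 <+> X2)) \<union> \<theta> ` carrier P"
    and \<eta>1: "\<And>A x y. A \<in> carrier P \<Longrightarrow> x \<in> X1 \<Longrightarrow> y \<in> X1 \<Longrightarrow> d3 (\<eta> (A, Inl x)) (\<eta> (A, Inl y)) = d1 x y"
    and \<eta>2: "\<And>A x y. A \<in> carrier P \<Longrightarrow> x \<in> X2 \<Longrightarrow> y \<in> X2 \<Longrightarrow> d3 (\<eta> (A, Inr x)) (\<eta> (A, Inr y)) = d2 x y"
    and \<theta>: "inj_on \<theta> (carrier P)"
      "\<And>A u. A \<in> carrier P \<Longrightarrow> u \<in> X3 \<Longrightarrow> u \<noteq> \<theta> A \<Longrightarrow> 1 \<le> d3 (\<theta> A) u"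
    by (rule amalgam_with_discrete_orbit) (rule that; assumption)
  from amalgam have "isometric_action P X3 d3 \<phi>3"
    by (simp add: amalgam_of_actions_def)
  then have M3: "Metric_space X3 d3"
    by (rule isometric_actionD(1))
  from amalgam obtain \<rho>1 \<rho>2 where
    emb1: "isometric_embedding X1 d1 X3 d3 \<rho>1" and emb2: "isometric_embedding X2 d2 X3 d3 \<rho>2"
    unfolding amalgam_of_actions_def by blast
  interpret M3: Metric_space X3 d3 by (rule M3)

  obtain D1 where D1: "metric_dense X1 d1 D1" "dens X1 d1 = |D1|"
    using dens_least(1)[OF M1.Metric_space_axioms] by blast
  obtain D2 where D2: "metric_dense X2 d2 D2" "dens X2 d2 = |D2|"
    using dens_least(1)[OF M2.Metric_space_axioms] by blast
  obtain D3 where D3: "metric_dense X3 d3 D3" "dens X3 d3 = |D3|"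
    using dens_least(1)[OF M3] by blast
  note dense1 = D1(1)[unfolded metric_dense_iff[OF M1.Metric_space_axioms]]
    and dense2 = D2(1)[unfolded metric_dense_iff[OF M2.Metric_space_axioms]]
    and dense3 = D3(1)[unfolded metric_dense_iff[OF M3]]

  let ?E = "\<eta> ` (carrier P \<times> (D1 <+> D2)) \<union> \<theta> ` carrier P"
  have "metric_dense X3 d3 ?E"
    unfolding metric_dense_iff[OF M3]
  proof (intro conjI ballI allI impI)
    show "?E \<subseteq> X3"
      unfolding X3 using dense1 dense2 by (intro Un_mono image_mono Sigma_mono) auto
    fix u and r :: real assume "u \<in> X3" and r: "0 < r"
    then consider A where "A \<in> carrier P" "u = \<theta> A"
      | A x where "A \<in> carrier P" "x \<in> X1" "u = \<eta> (A, Inl x)"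
      | A x where "A \<in> carrier P" "x \<in> X2" "u = \<eta> (A, Inr x)"
      unfolding X3 by blast
    then show "\<exists>y\<in>?E. d3 u y < r"
    proof cases
      case 1
      then show ?thesis using r \<open>u \<in> X3\<close> by (intro bexI[of _ u]) auto
    next
      case 2
      obtain z where z: "z \<in> D1" "d1 x z < r" using dense1 2 r by blast
      then have "d3 u (\<eta> (A, Inl z)) < r" using 2 dense1 \<eta>1[of A x z] by auto
      then show ?thesis using z 2 by blast
    next
      case 3
      obtain z where z: "z \<in> D2" "d2 x z < r" using dense2 3 r by blast
      then have "d3 u (\<eta> (A, Inr z)) < r" using 3 dense2 \<eta>2[of A x z] by auto
      then show ?thesis using z 3 by blast
    qed
  qed
  from dens_least(2)[OF M3 this] have "|D3| \<le>o |?E|"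
    unfolding D3(2) .
  also have "|?E| \<le>o |carrier P \<times> (D1 <+> D2) <+> carrier P|"
    by (rule ordLeq_transitive[OF card_of_Un_Plus_ordLeq card_of_Plus_mono[OF card_of_image card_of_image]])
  finally have D3_le: "|D3| \<le>o |carrier P \<times> (D1 <+> D2) <+> carrier P|" .

  have "\<theta> A \<in> D3" if A: "A \<in> carrier P" for A
  proof -
    have "\<theta> A \<in> X3" using A X3 by blast
    then obtain u where u: "u \<in> D3" "d3 (\<theta> A) u < 1"
      using dense3 zero_less_one[where 'a = real] by blast
    then have "u \<in> X3" using dense3 by blast
    with \<theta>(2)[OF A, of u] u show ?thesis by (cases "u = \<theta> A") simp_all
  qed
  then have P_le: "|carrier P| \<le>o |D3|"
    using \<theta>(1) by (intro card_of_ordLeqI) auto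

  have co: "Card_order |carrier P|" "Card_order (dens X1 d1)" "Card_order (dens X2 d2)"
    by (simp_all add: D1(2) D2(2) card_of_Card_order)
  note inner = card_max_bounds[OF co(2,3)]
  note outer = card_max_bounds[OF co(1) inner(1)]
  have \<kappa>_inf: "cinfinite \<kappa> \<longleftrightarrow> infinite (carrier P) \<or> infinite D1 \<or> infinite D2"
    unfolding outer(5) inner(5) unfolding D1(2) D2(2) by (simp add: cinfinite_def Field_card_of)
  have D3_inf: "cinfinite (dens X3 d3) \<longleftrightarrow> infinite D3"
    by (simp add: D3(2) cinfinite_def Field_card_of)
  have "if cinfinite \<kappa> then dens X3 d3 =o \<kappa> else \<not> cinfinite (dens X3 d3)"
  proof (cases "cinfinite \<kappa>")
    case True
    have inf3: "infinite D3"
    proof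
      assume fin: "finite D3"
      then have "finite (carrier P)"
        using P_le card_of_ordLeq_finite by blast
      moreover have fin3: "finite X3"
        by (rule finite_metric_dense[OF M3 D3(1) fin])
      have "finite X1" "finite X2"
        using finite_isometric_embedding[OF M1.Metric_space_axioms M3 emb1 fin3]
          finite_isometric_embedding[OF M2.Metric_space_axioms M3 emb2 fin3] by simp_all
      then have "finite D1" "finite D2"
        using dense1 dense2 by (meson finite_subset)+
      ultimately show False using True \<kappa>_inf by blast
    qed
    have "\<kappa> \<le>o dens X3 d3"
      unfolding D3(2)
      by (intro outer(4) inner(4) P_le dens_isometric_embedding[OF _ M3 emb1 D3(1) inf3]
          dens_isometric_embedding[OF _ M3 emb2 D3(1) inf3] M1.Metric_space_axioms M2.Metric_space_axioms)
    moreover have "dens X3 d3 \<le>o \<kappa>"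
    proof -
      have le: "|carrier P| \<le>o \<kappa>" "|D1| \<le>o \<kappa>" "|D2| \<le>o \<kappa>"
        using outer(2) ordLeq_transitive[OF inner(2) outer(3)] ordLeq_transitive[OF inner(3) outer(3)]
        by (simp_all add: D1(2) D2(2))
      have \<kappa>: "infinite (Field \<kappa>)" "Card_order \<kappa>"
        using True outer(1) by (simp_all add: cinfinite_def)
      have "|carrier P \<times> (D1 <+> D2) <+> carrier P| \<le>o \<kappa>"
        by (intro card_of_Plus_ordLeq_infinite_Field card_of_Times_ordLeq_infinite_Field le \<kappa>)
      then show ?thesis
        unfolding D3(2) by (rule ordLeq_transitive[OF D3_le])
    qed
    ultimately show ?thesis
      using True by (simp add: ordIso_iff_ordLeq)
  next
    case False
    then have "finite (carrier P \<times> (D1 <+> D2) <+> carrier P)" using \<kappa>_inf by simp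
    then have "finite D3" using D3_le card_of_ordLeq_finite by blast
    then show ?thesis using False D3_inf by simp
  qed
  with amalgam show ?thesis by blast
qed

end

theorem theorem0p2:
  fixes G1 G2 :: "'g monoid" and G0 :: "'g set"
    and X0 X1 X2 :: "'x set"
    and d1 d2 :: "'x \<Rightarrow> 'x \<Rightarrow> real"
    and \<phi>1 \<phi>2 :: "'g \<Rightarrow> 'x \<Rightarrow> 'x"
  assumes "group G1" and "group G2"
    and "subgroup G0 G1" and "subgroup G0 G2"
    and "\<And>g h. g \<in> G0 \<Longrightarrow> h \<in> G0 \<Longrightarrow> g \<otimes>\<^bsub>G1\<^esub> h = g \<otimes>\<^bsub>G2\<^esub> h"
    and "isometric_action G1 X1 d1 \<phi>1" and "isometric_action G2 X2 d2 \<phi>2"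
    and "X0 \<subseteq> X1" and "X0 \<subseteq> X2" and "X0 \<noteq> {}"
    and "\<And>x y. x \<in> X0 \<Longrightarrow> y \<in> X0 \<Longrightarrow> d1 x y = d2 x y"
    and "\<And>g x. g \<in> G0 \<Longrightarrow> x \<in> X0 \<Longrightarrow> \<phi>1 g x \<in> X0"
    and "\<And>g x. g \<in> G0 \<Longrightarrow> x \<in> X0 \<Longrightarrow> \<phi>1 g x = \<phi>2 g x"
  shows "\<exists>(X3 :: ((('g + 'g) list set \<times> ('x + 'x)) set \<times> ('g + 'g) list set) set) d3 \<phi>3.
    amalgam_of_actions G1 G0 G2 X0 X1 d1 \<phi>1 X2 d2 \<phi>2 X3 d3 \<phi>3 \<and>
    (let \<kappa> = card_max (card_of (carrier (amalg_prod G1 G0 G2))) (card_max (dens X1 d1) (dens X2 d2))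
     in if cinfinite \<kappa> then dens X3 d3 =o \<kappa> else \<not> cinfinite (dens X3 d3))"
proof -
  interpret amalgamation_problem G1 G2 G0 X0 X1 X2 d1 d2 \<phi>1 \<phi>2
    by (rule amalgamation_problem.intro) (fact assms)+
  show ?thesis
    using amalgam_exists by (simp only: Let_def)
qed

end
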